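(* Let $R$ be a Noetherian $\mathbb{N}$-graded domain and let $I\subseteq R$ be a nonzero proper graded ideal such that the symbolic Rees algebra $\mathcal{R}_s(I)=\bigoplus_{k\ge 0}I^{(k)}t^k$ is Noetherian. Then $$\lim_{k\to\infty}\frac{\mathrm{v}(I^{(k)})}{k}=\hat{\alpha}(I),$$ where $\hat{\alpha}(I)$ is the Waldschmidt constant of $I$.
   Context: $\mathbb{N}$ is the set of non-negative integers; rings are commutative with unity. The $k$-th symbolic power $I^{(k)}$ of an ideal $I$ of a Noetherian ring $R$ is defined by one of the following two conventions: (1) $I^{(k)}=\bigcap_{P\in\mathrm{Ass}(R/I)}(I^kR_P\cap R)$; (2) $I^{(k)}=\bigcap_{P\in\mathrm{Min}(I)}(I^kR_P\cap R)$, where $\mathrm{Min}(I)$ is the set of minimal primes of $I$. The result is asserted for either convention (the same convention being used throughout the statement). Set $I^{(0)}=R$. For a nonzero graded ideal $J$, $\alpha(J)=\min\{d\mid J_d\ne 0\}$. The Waldschmidt constant is $\hat{\alpha}(I)=\lim_{k\to\infty}\frac{\alpha(I^{(k)})}{k}$. For a proper graded ideal $J$, $\mathrm{Ass}(J)$ is the set of associated primes of $R/J$, and the v-number is $$\mathrm{v}(J)=\min\{d\ge 0\mid \text{there exist } f\in R_d \text{ and } \mathfrak{p}\in\mathrm{Ass}(J)\text{ with } (J:f)=\mathfrak{p}\}.$$ *)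

theory Defs
  imports "HOL-Algebra.Algebra" Complex_Main
begin

definition is_homogeneous_decomposition ::
    "('a, 'b) ring_scheme \<Rightarrow> (nat \<Rightarrow> 'a set) \<Rightarrow> 'a \<Rightarrow> (nat \<Rightarrow> 'a) \<Rightarrow> bool" where
  "is_homogeneous_decomposition R A x f \<longleftrightarrow>
     (\<forall>i. f i \<in> A i) \<and> finite {i. f i \<noteq> \<zero>\<^bsub>R\<^esub>} \<and>
     x = (\<Oplus>\<^bsub>R\<^esub>i \<in> {i. f i \<noteq> \<zero>\<^bsub>R\<^esub>}. f i)"

text \<open>\<open>A d\<close> is the graded piece of degree \<open>d\<close>; the last clause says that \<open>R\<close> is the
  (internal) direct sum of these pieces.\<close>

definition nat_graded :: "('a, 'b) ring_scheme \<Rightarrow> (nat \<Rightarrow> 'a set) \<Rightarrow> bool" where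
  "nat_graded R A \<longleftrightarrow>
     (\<forall>i. additive_subgroup (A i) R) \<and>
     (\<forall>i j. \<forall>a \<in> A i. \<forall>b \<in> A j. a \<otimes>\<^bsub>R\<^esub> b \<in> A (i + j)) \<and>
     (\<forall>x \<in> carrier R. \<exists>!f. is_homogeneous_decomposition R A x f)"

definition graded_ideal :: "('a, 'b) ring_scheme \<Rightarrow> (nat \<Rightarrow> 'a set) \<Rightarrow> 'a set \<Rightarrow> bool" where
  "graded_ideal R A J \<longleftrightarrow> ideal J R \<and>
     (\<forall>x \<in> J. \<forall>f. is_homogeneous_decomposition R A x f \<longrightarrow> (\<forall>i. f i \<in> J))"

text \<open>The associated primes of the \<open>R\<close>-module \<open>R/J\<close>: the prime ideals which are annihilators of
  an element \<open>x\<close> of \<open>R/J\<close>, where \<open>r\<close> acts on \<open>R/J\<close> as multiplication by its residue class.\<close>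

definition Ass :: "('a, 'b) ring_scheme \<Rightarrow> 'a set \<Rightarrow> 'a set set" where
  "Ass R J = {P. primeideal P R \<and>
     (\<exists>x \<in> carrier (R Quot J).
        P = {r \<in> carrier R. (J +>\<^bsub>R\<^esub> r) \<otimes>\<^bsub>R Quot J\<^esub> x = \<zero>\<^bsub>R Quot J\<^esub>})}"

definition Min_primes :: "('a, 'b) ring_scheme \<Rightarrow> 'a set \<Rightarrow> 'a set set" where
  "Min_primes R J = {P. primeideal P R \<and> J \<subseteq> P \<and>
     (\<forall>Q. primeideal Q R \<and> J \<subseteq> Q \<and> Q \<subseteq> P \<longrightarrow> Q = P)}"

definition colon :: "('a, 'b) ring_scheme \<Rightarrow> 'a set \<Rightarrow> 'a \<Rightarrow> 'a set" where
  "colon R J f = {r \<in> carrier R. r \<otimes>\<^bsub>R\<^esub> f \<in> J}"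

text \<open>\<open>S\<close> is meant to be a multiplicatively closed subset of \<open>R\<close> containing \<open>1\<close>;
  \<open>loc_frac R S r s\<close> is the fraction \<open>r/s\<close>. Sums and products are formed on
  all representatives; since the resulting fractions all coincide, the unions in
  \<open>localization\<close> are just that common fraction.\<close>

definition loc_rel :: "('a, 'b) ring_scheme \<Rightarrow> 'a set \<Rightarrow> (('a \<times> 'a) \<times> ('a \<times> 'a)) set" where
  "loc_rel R S = {((r, s), (r', s')). r \<in> carrier R \<and> r' \<in> carrier R \<and> s \<in> S \<and> s' \<in> S \<and>
     (\<exists>u \<in> S. u \<otimes>\<^bsub>R\<^esub> (r \<otimes>\<^bsub>R\<^esub> s' \<ominus>\<^bsub>R\<^esub> r' \<otimes>\<^bsub>R\<^esub> s) = \<zero>\<^bsub>R\<^esub>)}"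

definition loc_frac :: "('a, 'b) ring_scheme \<Rightarrow> 'a set \<Rightarrow> 'a \<Rightarrow> 'a \<Rightarrow> ('a \<times> 'a) set" where
  "loc_frac R S r s = loc_rel R S `` {(r, s)}"

definition localization :: "('a, 'b) ring_scheme \<Rightarrow> 'a set \<Rightarrow> ('a \<times> 'a) set ring" where
  "localization R S = \<lparr>
     carrier = (carrier R \<times> S) // loc_rel R S,
     monoid.mult = (\<lambda>U V. \<Union>p \<in> U. \<Union>q \<in> V.
       loc_frac R S (fst p \<otimes>\<^bsub>R\<^esub> fst q) (snd p \<otimes>\<^bsub>R\<^esub> snd q)),
     one = loc_frac R S \<one>\<^bsub>R\<^esub> \<one>\<^bsub>R\<^esub>,
     ring.zero = loc_frac R S \<zero>\<^bsub>R\<^esub> \<one>\<^bsub>R\<^esub>,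
     ring.add = (\<lambda>U V. \<Union>p \<in> U. \<Union>q \<in> V.
       loc_frac R S (fst p \<otimes>\<^bsub>R\<^esub> snd q \<oplus>\<^bsub>R\<^esub> fst q \<otimes>\<^bsub>R\<^esub> snd p)
         (snd p \<otimes>\<^bsub>R\<^esub> snd q))\<rparr>"

text \<open>\<open>J R\<^sub>P \<inter> R\<close>: the preimage under \<open>R \<rightarrow> R\<^sub>P\<close>, \<open>r \<mapsto> r/1\<close>, of the ideal of
  \<open>R\<^sub>P\<close> generated by the image of \<open>J\<close>.\<close>

definition loc_contraction :: "('a, 'b) ring_scheme \<Rightarrow> 'a set \<Rightarrow> 'a set \<Rightarrow> 'a set" where
  "loc_contraction R P J =
     {r \<in> carrier R. loc_frac R (carrier R - P) r \<one>\<^bsub>R\<^esub> \<in>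
        Idl\<^bsub>localization R (carrier R - P)\<^esub>
          ((\<lambda>a. loc_frac R (carrier R - P) a \<one>\<^bsub>R\<^esub>) ` J)}"

text \<open>Two conventions for symbolic powers are in use: the intersection is taken over all
  associated primes, or over the minimal primes only.\<close>

datatype symbolic_convention = Associated | Minimal

fun symbolic_primes ::
    "('a, 'b) ring_scheme \<Rightarrow> symbolic_convention \<Rightarrow> 'a set \<Rightarrow> 'a set set" where
  "symbolic_primes R Associated I = Ass R I"
| "symbolic_primes R Minimal I = Min_primes R I"

definition symbolic_power ::
    "('a, 'b) ring_scheme \<Rightarrow> symbolic_convention \<Rightarrow> 'a set \<Rightarrow> nat \<Rightarrow> 'a set" where
  "symbolic_power R c I k =
     (if k = 0 then carrier R
      else carrier R \<inter>
        (\<Inter>P \<in> symbolic_primes R c I. loc_contraction R P (I [^]\<^bsub>ideals_set R\<^esub> k)))"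

text \<open>The symbolic Rees algebra, as the subring of \<open>R[t]\<close> of all polynomials whose coefficient of
  \<open>t\<^sup>k\<close> lies in the \<open>k\<close>-th symbolic power.\<close>

definition symbolic_Rees_algebra ::
    "('a, 'b) ring_scheme \<Rightarrow> symbolic_convention \<Rightarrow> 'a set \<Rightarrow> ('a, nat \<Rightarrow> 'a) up_ring" where
  "symbolic_Rees_algebra R c I =
     (UP R)\<lparr>carrier := {p \<in> carrier (UP R). \<forall>k. coeff (UP R) p k \<in> symbolic_power R c I k}\<rparr>"

definition initial_degree :: "('a, 'b) ring_scheme \<Rightarrow> (nat \<Rightarrow> 'a set) \<Rightarrow> 'a set \<Rightarrow> nat" where
  "initial_degree R A J = (LEAST d. J \<inter> A d \<noteq> {\<zero>\<^bsub>R\<^esub>})"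

definition Waldschmidt_constant ::
    "('a, 'b) ring_scheme \<Rightarrow> (nat \<Rightarrow> 'a set) \<Rightarrow> symbolic_convention \<Rightarrow> 'a set \<Rightarrow> real" where
  "Waldschmidt_constant R A c I =
     lim (\<lambda>k. real (initial_degree R A (symbolic_power R c I k)) / real k)"

definition v_number :: "('a, 'b) ring_scheme \<Rightarrow> (nat \<Rightarrow> 'a set) \<Rightarrow> 'a set \<Rightarrow> nat" where
  "v_number R A J = (LEAST d. \<exists>f \<in> A d. \<exists>P \<in> Ass R J. colon R J f = P)"

end

theory Submission
  imports Defs
begin

text \<open>Write \<open>J k\<close> for the \<open>k\<close>-th symbolic power. If \<open>(J k : f) = P\<close> is prime and \<open>g\<close> is a fixed
  nonzero homogeneous element of \<open>J 1\<close>, then \<open>g\<^sup>k \<in> P\<close>, so \<open>g f\<close> is a nonzero element of \<open>J k\<close>;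
  hence \<open>v(J k) \<ge> \<alpha>(J k) - deg g\<close>.

  For the upper bound, finite generation gives some \<open>u \<in> J m\<close> with \<open>deg u / m\<close> equal to the
  Waldschmidt constant. Take multiples \<open>w n \<in> J (\<kappa> n)\<close> of each other, with bounded steps
  \<open>\<kappa> (n + 1) - \<kappa> n\<close> and \<open>w n \<notin> J (\<kappa> n + 1)\<close>. For fixed \<open>s \<ge> 1\<close> the proper ideals
  \<open>(J (\<kappa> n + s) : w n)\<close> increase with \<open>n\<close>, so they stabilise at some \<open>L\<close>, and \<open>(L : g)\<close> is prime for
  some homogeneous \<open>g\<close>; thus \<open>v(J (\<kappa> n + s)) \<le> deg (w n) + deg g\<close>. If the Waldschmidt constant is
  positive, \<open>w n = u\<^sup>n\<close> works for degree reasons. If it is zero, the \<open>w n\<close> are products of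
  degree-zero elements; if no such sequence existed, the degree-zero parts of the \<open>J k\<close> would
  become constant and Nakayama's lemma would make them vanish.\<close>

section \<open>Localization of a domain\<close>

text \<open>Two-sided, because it is also applied to the symbolic Rees algebra, which is given only
  as a Noetherian ring, without commutativity. Negatives come from multiplication by -1.\<close>

lemma (in ring) ideal_by_closure:
  assumes "J \<subseteq> carrier R" "\<zero> \<in> J"
    and "\<And>x y. x \<in> J \<Longrightarrow> y \<in> J \<Longrightarrow> x \<oplus> y \<in> J"
    and "\<And>r x. r \<in> carrier R \<Longrightarrow> x \<in> J \<Longrightarrow> r \<otimes> x \<in> J"
    and "\<And>r x. r \<in> carrier R \<Longrightarrow> x \<in> J \<Longrightarrow> x \<otimes> r \<in> J"
  shows "ideal J R"
proof (rule idealI)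
  show "subgroup J (add_monoid R)"
  proof (rule add.subgroupI)
    fix a assume "a \<in> J"
    then have "(\<ominus> \<one>) \<otimes> a \<in> J" using assms(4) by simp
    with \<open>a \<in> J\<close> show "\<ominus> a \<in> J" using assms(1) l_minus by auto
  qed (use assms in auto)
qed (use assms ring_axioms in auto)

lemma (in cring) cring_ideal_by_closure:
  assumes "J \<subseteq> carrier R" "\<zero> \<in> J"
    and "\<And>x y. x \<in> J \<Longrightarrow> y \<in> J \<Longrightarrow> x \<oplus> y \<in> J"
    and "\<And>r x. r \<in> carrier R \<Longrightarrow> x \<in> J \<Longrightarrow> r \<otimes> x \<in> J"
  shows "ideal J R"
proof (rule ideal_by_closure)
  fix r x assume "r \<in> carrier R" "x \<in> J"
  then show "x \<otimes> r \<in> J" using assms(1) assms(4) m_comm by (metis subsetD)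
qed (use assms in auto)

locale domain_localization = domain R for R (structure) +
  fixes S :: "'a set"
  assumes S_carrier: "S \<subseteq> carrier R"
    and one_S: "\<one> \<in> S"
    and mult_S: "s \<in> S \<Longrightarrow> s' \<in> S \<Longrightarrow> s \<otimes> s' \<in> S"
    and zero_notin_S: "\<zero> \<notin> S"
begin

abbreviation frac :: "'a \<Rightarrow> 'a \<Rightarrow> ('a \<times> 'a) set" where
  "frac \<equiv> loc_frac R S"

abbreviation L :: "('a \<times> 'a) set ring" where
  "L \<equiv> localization R S"

lemma S_closed [simp]: "s \<in> S \<Longrightarrow> s \<in> carrier R"
  using S_carrier by blast

lemma S_nonzero: "s \<in> S \<Longrightarrow> s \<noteq> \<zero>"
  using zero_notin_S by blast

text \<open>In a domain the multiplier \<open>u\<close> is nonzero and cancels, so equality of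
  fractions is cross multiplication.\<close>

lemma loc_rel_iff:
  "((r, s), (r', s')) \<in> loc_rel R S \<longleftrightarrow>
    r \<in> carrier R \<and> r' \<in> carrier R \<and> s \<in> S \<and> s' \<in> S \<and> r \<otimes> s' = r' \<otimes> s"
proof (cases "r \<in> carrier R \<and> r' \<in> carrier R \<and> s \<in> S \<and> s' \<in> S")
  case True
  then have c: "r \<otimes> s' \<ominus> r' \<otimes> s \<in> carrier R" by simp
  have "(\<exists>u\<in>S. u \<otimes> (r \<otimes> s' \<ominus> r' \<otimes> s) = \<zero>) \<longleftrightarrow> r \<otimes> s' \<ominus> r' \<otimes> s = \<zero>"
    using c one_S S_nonzero integral_iff[OF _ c] by auto
  also have "\<dots> \<longleftrightarrow> r \<otimes> s' = r' \<otimes> s" using True by simp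
  finally show ?thesis using True by (auto simp: loc_rel_def)
qed (auto simp: loc_rel_def)

lemma equiv_loc_rel: "equiv (carrier R \<times> S) (loc_rel R S)"
proof (rule equivI)
  show "loc_rel R S \<subseteq> (carrier R \<times> S) \<times> (carrier R \<times> S)" by (auto simp: loc_rel_iff)
  show "refl_on (carrier R \<times> S) (loc_rel R S)" by (auto simp: refl_on_def loc_rel_iff)
  show "sym (loc_rel R S)" by (auto simp: sym_def loc_rel_iff)
  show "trans (loc_rel R S)"
  proof (rule transI, clarify)
    fix r s r' s' r'' s''
    assume "((r, s), (r', s')) \<in> loc_rel R S" "((r', s'), (r'', s'')) \<in> loc_rel R S"
    then have *: "r \<in> carrier R" "r' \<in> carrier R" "r'' \<in> carrier R" "s \<in> S" "s' \<in> S" "s'' \<in> S"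
      "r \<otimes> s' = r' \<otimes> s" "r' \<otimes> s'' = r'' \<otimes> s'" by (auto simp: loc_rel_iff)
    have "s' \<otimes> (r \<otimes> s'') = (r \<otimes> s') \<otimes> s''" using *(1-6) by (simp add: m_ac)
    also have "\<dots> = (r' \<otimes> s'') \<otimes> s" unfolding *(7) using *(1-6) by (simp add: m_ac)
    also have "\<dots> = s' \<otimes> (r'' \<otimes> s)" unfolding *(8) using *(1-6) by (simp add: m_ac)
    finally have "r \<otimes> s'' = r'' \<otimes> s"
      using * S_nonzero m_lcancel[of s' "r \<otimes> s''" "r'' \<otimes> s"] by simp
    then show "((r, s), (r'', s'')) \<in> loc_rel R S" using * by (simp add: loc_rel_iff)
  qed
qed

lemma frac_eq_iff:
  assumes "r \<in> carrier R" "s \<in> S" "r' \<in> carrier R" "s' \<in> S"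
  shows "frac r s = frac r' s' \<longleftrightarrow> r \<otimes> s' = r' \<otimes> s"
  using assms eq_equiv_class_iff[OF equiv_loc_rel, of "(r, s)" "(r', s')"]
  by (simp add: loc_frac_def loc_rel_iff)

lemma carrier_L: "carrier L = {frac r s | r s. r \<in> carrier R \<and> s \<in> S}"
  by (auto simp: localization_def quotient_def loc_frac_def)

lemma frac_closed [simp]: "r \<in> carrier R \<Longrightarrow> s \<in> S \<Longrightarrow> frac r s \<in> carrier L"
  by (auto simp: carrier_L)

text \<open>The value \<open>?f\<close> respects \<open>loc_rel\<close> in both arguments, so the
  unions over representatives in \<open>localization\<close> collapse to a single fraction.\<close>

lemma frac_mult:
  assumes "r \<in> carrier R" "s \<in> S" "r' \<in> carrier R" "s' \<in> S"
  shows "frac r s \<otimes>\<^bsub>L\<^esub> frac r' s' = frac (r \<otimes> r') (s \<otimes> s')"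
proof -
  let ?f = "\<lambda>p q. frac (fst p \<otimes> fst q) (snd p \<otimes> snd q)"
  have "congruent2 (loc_rel R S) (loc_rel R S) ?f"
  proof (rule congruent2I'[of "loc_rel R S" "loc_rel R S"], clarsimp)
    fix r s r' s' t u t' u'
    assume "((r, s), (r', s')) \<in> loc_rel R S" "((t, u), (t', u')) \<in> loc_rel R S"
    then have *: "r \<in> carrier R" "r' \<in> carrier R" "t \<in> carrier R" "t' \<in> carrier R"
      "s \<in> S" "s' \<in> S" "u \<in> S" "u' \<in> S"
      "r \<otimes> s' = r' \<otimes> s" "t \<otimes> u' = t' \<otimes> u" by (auto simp: loc_rel_iff)
    have "(r \<otimes> t) \<otimes> (s' \<otimes> u') = (r \<otimes> s') \<otimes> (t \<otimes> u')" using *(1-8) by (simp add: m_ac)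
    also have "\<dots> = (r' \<otimes> t') \<otimes> (s \<otimes> u)" unfolding *(9,10) using *(1-8) by (simp add: m_ac)
    finally show "frac (r \<otimes> t) (s \<otimes> u) = frac (r' \<otimes> t') (s' \<otimes> u')"
      using * by (simp add: frac_eq_iff mult_S)
  qed
  from UN_equiv_class2[OF equiv_loc_rel equiv_loc_rel this, of "(r, s)" "(r', s')"] assms
  show ?thesis by (simp add: localization_def loc_frac_def)
qed

lemma frac_add:
  assumes "r \<in> carrier R" "s \<in> S" "r' \<in> carrier R" "s' \<in> S"
  shows "frac r s \<oplus>\<^bsub>L\<^esub> frac r' s' = frac (r \<otimes> s' \<oplus> r' \<otimes> s) (s \<otimes> s')"
proof -
  let ?f = "\<lambda>p q. frac (fst p \<otimes> snd q \<oplus> fst q \<otimes> snd p) (snd p \<otimes> snd q)"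
  have "congruent2 (loc_rel R S) (loc_rel R S) ?f"
  proof (rule congruent2I'[of "loc_rel R S" "loc_rel R S"], clarsimp)
    fix r s r' s' t u t' u'
    assume "((r, s), (r', s')) \<in> loc_rel R S" "((t, u), (t', u')) \<in> loc_rel R S"
    then have *: "r \<in> carrier R" "r' \<in> carrier R" "t \<in> carrier R" "t' \<in> carrier R"
      "s \<in> S" "s' \<in> S" "u \<in> S" "u' \<in> S"
      "r \<otimes> s' = r' \<otimes> s" "t \<otimes> u' = t' \<otimes> u" by (auto simp: loc_rel_iff)
    have "(r \<otimes> u \<oplus> t \<otimes> s) \<otimes> (s' \<otimes> u') = (r \<otimes> s') \<otimes> (u \<otimes> u') \<oplus> (t \<otimes> u') \<otimes> (s \<otimes> s')"
      using *(1-8) by (simp add: m_ac l_distr r_distr)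
    also have "\<dots> = (r' \<otimes> u' \<oplus> t' \<otimes> s') \<otimes> (s \<otimes> u)"
      unfolding *(9,10) using *(1-8) by (simp add: m_ac l_distr r_distr)
    finally show "frac (r \<otimes> u \<oplus> t \<otimes> s) (s \<otimes> u) = frac (r' \<otimes> u' \<oplus> t' \<otimes> s') (s' \<otimes> u')"
      using * by (simp add: frac_eq_iff mult_S)
  qed
  from UN_equiv_class2[OF equiv_loc_rel equiv_loc_rel this, of "(r, s)" "(r', s')"] assms
  show ?thesis by (simp add: localization_def loc_frac_def)
qed

lemma one_L: "\<one>\<^bsub>L\<^esub> = frac \<one> \<one>" and zero_L: "\<zero>\<^bsub>L\<^esub> = frac \<zero> \<one>"
  by (simp_all add: localization_def)

lemma cring_localization: "cring L"
proof (rule cringI)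
  show "abelian_group L"
  proof (rule abelian_groupI)
    fix x assume "x \<in> carrier L"
    then obtain r s where x: "x = frac r s" "r \<in> carrier R" "s \<in> S" by (auto simp: carrier_L)
    then have "frac (\<ominus> r) s \<oplus>\<^bsub>L\<^esub> x = \<zero>\<^bsub>L\<^esub>"
      by (simp add: frac_add zero_L frac_eq_iff one_S mult_S l_minus l_neg)
    then show "\<exists>y\<in>carrier L. y \<oplus>\<^bsub>L\<^esub> x = \<zero>\<^bsub>L\<^esub>" using x by (intro bexI) auto
  qed (auto simp: carrier_L frac_add zero_L frac_eq_iff one_S mult_S m_ac a_ac l_distr r_distr,
      use mult_S one_S in \<open>blast intro: add.m_closed m_closed S_closed\<close>,
      use one_S in blast)
  show "Group.comm_monoid L"
    by (rule comm_monoidI)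
      (auto simp: carrier_L frac_mult one_L frac_eq_iff one_S mult_S m_ac,
        use mult_S one_S in \<open>blast intro: add.m_closed m_closed S_closed\<close>,
        use one_S in blast)
  fix x y z assume "x \<in> carrier L" "y \<in> carrier L" "z \<in> carrier L"
  then obtain r s r' s' r'' s'' where *: "x = frac r s" "y = frac r' s'" "z = frac r'' s''"
    "r \<in> carrier R" "r' \<in> carrier R" "r'' \<in> carrier R" "s \<in> S" "s' \<in> S" "s'' \<in> S"
    by (auto simp: carrier_L)
  have "frac ((r \<otimes> s' \<oplus> r' \<otimes> s) \<otimes> r'') ((s \<otimes> s') \<otimes> s'') =
    frac ((r \<otimes> r'') \<otimes> (s' \<otimes> s'') \<oplus> (r' \<otimes> r'') \<otimes> (s \<otimes> s'')) ((s \<otimes> s'') \<otimes> (s' \<otimes> s''))"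
    using * mult_S by (subst frac_eq_iff) (simp_all add: m_ac l_distr r_distr)
  then show "(x \<oplus>\<^bsub>L\<^esub> y) \<otimes>\<^bsub>L\<^esub> z = x \<otimes>\<^bsub>L\<^esub> z \<oplus>\<^bsub>L\<^esub> y \<otimes>\<^bsub>L\<^esub> z"
    using * by (simp add: frac_add frac_mult mult_S)
qed

text \<open>The fractions with numerator in \<open>J\<close> already form an ideal of
  \<open>L\<close>, which bounds the generated ideal from above. Conversely, \<open>r / 1\<close> is
  recovered from \<open>(s r) / 1\<close> by multiplying with \<open>1 / s\<close>.\<close>

lemma frac_one_mem_genideal_iff:
  assumes J: "ideal J R" and r: "r \<in> carrier R"
  shows "frac r \<one> \<in> Idl\<^bsub>L\<^esub> ((\<lambda>a. frac a \<one>) ` J) \<longleftrightarrow> (\<exists>s\<in>S. s \<otimes> r \<in> J)"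
proof
  interpret L: cring L by (rule cring_localization)
  interpret J: ideal J R by (rule J)
  show "\<exists>s\<in>S. s \<otimes> r \<in> J" if mem: "frac r \<one> \<in> Idl\<^bsub>L\<^esub> ((\<lambda>a. frac a \<one>) ` J)"
  proof -
    let ?K = "{frac a s | a s. a \<in> J \<and> s \<in> S}"
    have "ideal ?K L"
    proof (rule L.cring_ideal_by_closure)
      show "?K \<subseteq> carrier L" by auto
      show "\<zero>\<^bsub>L\<^esub> \<in> ?K" using one_S J.zero_closed unfolding zero_L by blast
      fix x y assume "x \<in> ?K" "y \<in> ?K"
      then obtain a s b t where *: "x = frac a s" "y = frac b t" "a \<in> J" "b \<in> J" "s \<in> S" "t \<in> S"
        by blast
      then have "a \<otimes> t \<oplus> b \<otimes> s \<in> J" by (intro J.a_closed J.I_r_closed) auto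
      with * mult_S show "x \<oplus>\<^bsub>L\<^esub> y \<in> ?K" by (auto simp: frac_add)
    next
      fix x y assume "x \<in> carrier L" "y \<in> ?K"
      then obtain r s b t where *: "x = frac r s" "y = frac b t" "r \<in> carrier R" "b \<in> J" "s \<in> S" "t \<in> S"
        unfolding carrier_L by blast
      then have "r \<otimes> b \<in> J" by (intro J.I_l_closed) auto
      with * mult_S show "x \<otimes>\<^bsub>L\<^esub> y \<in> ?K" by (auto simp: frac_mult)
    qed
    moreover have "(\<lambda>a. frac a \<one>) ` J \<subseteq> ?K" using one_S by auto
    ultimately have "frac r \<one> \<in> ?K" using mem L.genideal_minimal by blast
    then obtain a s where "frac r \<one> = frac a s" "a \<in> J" "s \<in> S" by auto
    then have "s \<otimes> r \<in> J" using r one_S by (simp add: frac_eq_iff m_comm)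
    with \<open>s \<in> S\<close> show ?thesis ..
  qed
  assume "\<exists>s\<in>S. s \<otimes> r \<in> J"
  then obtain s where s: "s \<in> S" "s \<otimes> r \<in> J" by auto
  have sub: "(\<lambda>a. frac a \<one>) ` J \<subseteq> carrier L" using one_S by auto
  have "frac (s \<otimes> r) \<one> \<in> Idl\<^bsub>L\<^esub> ((\<lambda>a. frac a \<one>) ` J)"
    using L.genideal_self[OF sub] s by auto
  then have "frac \<one> s \<otimes>\<^bsub>L\<^esub> frac (s \<otimes> r) \<one> \<in> Idl\<^bsub>L\<^esub> ((\<lambda>a. frac a \<one>) ` J)"
    using s by (intro ideal.I_l_closed[OF L.genideal_ideal[OF sub]]) auto
  moreover have "frac \<one> s \<otimes>\<^bsub>L\<^esub> frac (s \<otimes> r) \<one> = frac r \<one>"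
    using s r one_S by (simp add: frac_mult frac_eq_iff m_comm)
  ultimately show "frac r \<one> \<in> Idl\<^bsub>L\<^esub> ((\<lambda>a. frac a \<one>) ` J)" by simp
qed

end

text \<open>Replaces localization by multipliers outside \<open>P\<close>; every later argument
  about symbolic powers uses this form.\<close>

lemma (in domain) loc_contraction_eq:
  assumes "primeideal P R" "ideal J R"
  shows "loc_contraction R P J = {r \<in> carrier R. \<exists>s\<in>carrier R - P. s \<otimes> r \<in> J}"
proof -
  interpret P: primeideal P R by fact
  interpret domain_localization R "carrier R - P"
    using P.I_prime P.I_notcarr P.one_imp_carrier by unfold_locales auto
  show ?thesis
    using frac_one_mem_genideal_iff[OF assms(2)] by (auto simp: loc_contraction_def)
qed

section \<open>Homogeneous components\<close>

locale graded_cring = cring R for R (structure) +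
  fixes A :: "nat \<Rightarrow> 'a set"
  assumes graded: "nat_graded R A"
begin

definition hcomp :: "nat \<Rightarrow> 'a \<Rightarrow> 'a" where
  "hcomp i x = (THE f. is_homogeneous_decomposition R A x f) i"

definition supp :: "'a \<Rightarrow> nat set" where
  "supp x = {i. hcomp i x \<noteq> \<zero>}"

lemma A_subgroup: "additive_subgroup (A i) R"
  using graded by (auto simp: nat_graded_def)

lemma A_carrier [simp]: "a \<in> A i \<Longrightarrow> a \<in> carrier R"
  by (rule additive_subgroup.a_Hcarr[OF A_subgroup])

lemma A_zero [simp]: "\<zero> \<in> A i"
  by (rule additive_subgroup.zero_closed[OF A_subgroup])

lemma A_add: "a \<in> A i \<Longrightarrow> b \<in> A i \<Longrightarrow> a \<oplus> b \<in> A i"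
  by (rule additive_subgroup.a_closed[OF A_subgroup])

lemma A_mult: "a \<in> A i \<Longrightarrow> b \<in> A j \<Longrightarrow> a \<otimes> b \<in> A (i + j)"
  using graded by (auto simp: nat_graded_def)

lemma decomposition_unique:
  "x \<in> carrier R \<Longrightarrow> \<exists>!f. is_homogeneous_decomposition R A x f"
  using graded by (auto simp: nat_graded_def)

lemma hcomp_eq:
  assumes "x \<in> carrier R" "is_homogeneous_decomposition R A x f"
  shows "hcomp i x = f i"
  unfolding hcomp_def using the1_equality[OF decomposition_unique, OF assms] by simp

lemma hcomp_decomposition:
  assumes "x \<in> carrier R"
  shows "is_homogeneous_decomposition R A x (\<lambda>i. hcomp i x)"
  using theI'[OF decomposition_unique[OF assms]] by (simp add: hcomp_def)

lemma hcomp_A: "x \<in> carrier R \<Longrightarrow> hcomp i x \<in> A i"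
  using hcomp_decomposition by (auto simp: is_homogeneous_decomposition_def)

lemma hcomp_closed [simp]: "x \<in> carrier R \<Longrightarrow> hcomp i x \<in> carrier R"
  using hcomp_A A_carrier by blast

lemma finite_supp: "x \<in> carrier R \<Longrightarrow> finite (supp x)"
  using hcomp_decomposition by (auto simp: is_homogeneous_decomposition_def supp_def)

lemma sum_hcomp: "x \<in> carrier R \<Longrightarrow> x = (\<Oplus>i\<in>supp x. hcomp i x)"
  using hcomp_decomposition by (auto simp: is_homogeneous_decomposition_def supp_def)

lemma finsum_subset_support:
  assumes "finite F" "\<And>i. i \<in> F \<Longrightarrow> f i \<in> carrier R" "\<And>i. f i \<noteq> \<zero> \<Longrightarrow> i \<in> F"
  shows "(\<Oplus>i\<in>{i. f i \<noteq> \<zero>}. f i) = (\<Oplus>i\<in>F. f i)"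
proof -
  have "{i. f i \<noteq> \<zero>} \<subseteq> F" using assms(3) by auto
  then show ?thesis
    using assms(1,2) by (intro add.finprod_mono_neutral_cong_left) auto
qed

lemma hcomp_eq_sum:
  assumes "finite F" "\<And>i. f i \<in> A i" "\<And>i. i \<notin> F \<Longrightarrow> f i = \<zero>" "x = (\<Oplus>i\<in>F. f i)"
  shows "hcomp i x = f i"
proof (rule hcomp_eq)
  have f: "f i \<in> carrier R" for i using assms(2) A_carrier by blast
  then show "x \<in> carrier R" using assms(4) by auto
  have "{i. f i \<noteq> \<zero>} \<subseteq> F" using assms(3) by auto
  then have "finite {i. f i \<noteq> \<zero>}" using assms(1) finite_subset by blast
  moreover have "x = (\<Oplus>i\<in>{i. f i \<noteq> \<zero>}. f i)"
    using assms f by (subst finsum_subset_support[of F]) auto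
  ultimately show "is_homogeneous_decomposition R A x f"
    using assms(2) by (auto simp: is_homogeneous_decomposition_def)
qed

lemma sum_hcomp_superset:
  assumes "x \<in> carrier R" "finite F" "supp x \<subseteq> F"
  shows "x = (\<Oplus>i\<in>F. hcomp i x)"
  using sum_hcomp[OF assms(1)] finsum_subset_support[of F "\<lambda>i. hcomp i x"] assms
  by (auto simp: supp_def)

lemma hcomp_add:
  assumes "x \<in> carrier R" "y \<in> carrier R"
  shows "hcomp i (x \<oplus> y) = hcomp i x \<oplus> hcomp i y"
proof -
  define F where "F = supp x \<union> supp y"
  have F: "finite F" using assms finite_supp by (simp add: F_def)
  have "(\<Oplus>i\<in>F. hcomp i x \<oplus> hcomp i y) = (\<Oplus>i\<in>F. hcomp i x) \<oplus> (\<Oplus>i\<in>F. hcomp i y)"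
    using assms by (intro finsum_addf) auto
  also have "\<dots> = x \<oplus> y"
    using sum_hcomp_superset[OF assms(1) F, symmetric] sum_hcomp_superset[OF assms(2) F, symmetric]
    by (simp add: F_def)
  finally have sum: "x \<oplus> y = (\<Oplus>i\<in>F. hcomp i x \<oplus> hcomp i y)" by (rule sym)
  show ?thesis
  proof (rule hcomp_eq_sum[OF F _ _ sum])
    show "hcomp i x \<oplus> hcomp i y \<in> A i" for i
      using assms by (intro A_add hcomp_A)
    show "hcomp i x \<oplus> hcomp i y = \<zero>" if "i \<notin> F" for i
      using that by (simp add: F_def supp_def)
  qed
qed

lemma hcomp_homogeneous:
  assumes "a \<in> A n"
  shows "hcomp i a = (if i = n then a else \<zero>)"
proof (rule hcomp_eq_sum[where F = "{n}" and f = "\<lambda>i. if i = n then a else \<zero>"])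
  show "a = (\<Oplus>i\<in>{n}. if i = n then a else \<zero>)"
    using assms by (subst finsum_insert) auto
qed (use assms in \<open>simp_all split: if_splits\<close>)

lemma hcomp_zero [simp]: "hcomp i \<zero> = \<zero>"
  using hcomp_homogeneous[of \<zero> i i] by simp

lemma hcomp_self: "a \<in> A n \<Longrightarrow> hcomp n a = a"
  using hcomp_homogeneous by simp

lemma hcomp_minus:
  assumes "x \<in> carrier R"
  shows "hcomp i (\<ominus> x) = \<ominus> hcomp i x"
proof -
  have "hcomp i (\<ominus> x) \<oplus> hcomp i x = \<zero>"
    using hcomp_add[of "\<ominus> x" x i] assms by (simp add: l_neg)
  then show ?thesis using minus_equality[of "hcomp i (\<ominus> x)" "hcomp i x"] assms by simp
qed

lemma hcomp_diff:
  assumes "x \<in> carrier R" "y \<in> carrier R"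
  shows "hcomp i (x \<ominus> y) = hcomp i x \<ominus> hcomp i y"
  using assms by (simp add: a_minus_def hcomp_add hcomp_minus)

lemma supp_empty_iff:
  assumes "x \<in> carrier R" "supp x = {}"
  shows "x = \<zero>"
  using sum_hcomp[OF assms(1)] assms(2) by simp

lemma homogeneous_induct [consumes 1, case_names homogeneous add]:
  assumes "x \<in> carrier R"
    and hom: "\<And>a n. a \<in> A n \<Longrightarrow> P a"
    and add: "\<And>x y. x \<in> carrier R \<Longrightarrow> y \<in> carrier R \<Longrightarrow> P x \<Longrightarrow> P y \<Longrightarrow> P (x \<oplus> y)"
  shows "P x"
proof -
  have "P (\<Oplus>i\<in>F. hcomp i x)" if "finite F" for F
    using that
  proof (induction F rule: finite_induct)
    case empty
    show ?case using hom[of \<zero> 0] by simp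
  next
    case (insert i F)
    have "P (hcomp i x)" using hom hcomp_A assms(1) by blast
    then show ?case using insert assms(1) add by (subst finsum_insert) auto
  qed
  then show ?thesis using sum_hcomp finite_supp assms(1) by metis
qed

lemma hcomp_mult_homogeneous:
  assumes "a \<in> A n" "y \<in> carrier R"
  shows "hcomp i (a \<otimes> y) = (if n \<le> i then a \<otimes> hcomp (i - n) y else \<zero>)"
  using assms(2)
proof (induction y rule: homogeneous_induct)
  case (homogeneous b m)
  have "a \<otimes> b \<in> A (n + m)" using A_mult assms(1) homogeneous by blast
  then show ?case
    using hcomp_homogeneous[of "a \<otimes> b" "n + m" i] hcomp_homogeneous[OF homogeneous, of "i - n"] assms(1)
    by auto
next
  case (add x y)
  then show ?case using assms(1) by (auto simp: r_distr hcomp_add)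
qed

lemma hcomp_mult:
  assumes "x \<in> carrier R" "y \<in> carrier R"
  shows "hcomp n (x \<otimes> y) = (\<Oplus>i\<in>{..n}. hcomp i x \<otimes> hcomp (n - i) y)"
  using assms(1)
proof (induction x rule: homogeneous_induct)
  case (homogeneous a m)
  have eq: "hcomp i a \<otimes> hcomp (n - i) y = (if i = m then a \<otimes> hcomp (n - m) y else \<zero>)" for i
    using hcomp_homogeneous[OF homogeneous, of i] assms(2) by simp
  show ?case
  proof (cases "m \<le> n")
    case True
    then show ?thesis
      using hcomp_mult_homogeneous[OF homogeneous assms(2), of n] homogeneous assms(2)
        add.finprod_singleton[of m "{..n}" "\<lambda>i. a \<otimes> hcomp (n - m) y"] unfolding eq
      by (simp add: eq_commute[of m])
  next
    case False
    have "(\<Oplus>i\<in>{..n}. if i = m then a \<otimes> hcomp (n - m) y else \<zero>) = (\<Oplus>i\<in>{..n}. \<zero>)"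
      using False by (intro add.finprod_cong') auto
    with False show ?thesis
      using hcomp_mult_homogeneous[OF homogeneous assms(2), of n] unfolding eq by simp
  qed
next
  case (add u v)
  have "(\<Oplus>i\<in>{..n}. hcomp i (u \<oplus> v) \<otimes> hcomp (n - i) y) =
    (\<Oplus>i\<in>{..n}. hcomp i u \<otimes> hcomp (n - i) y \<oplus> hcomp i v \<otimes> hcomp (n - i) y)"
    using add assms(2) by (intro add.finprod_cong') (auto simp: hcomp_add l_distr)
  also have "\<dots> = hcomp n (u \<otimes> y) \<oplus> hcomp n (v \<otimes> y)"
    using add assms(2) by (subst finsum_addf) auto
  finally show ?case using add assms(2) by (simp add: l_distr hcomp_add)
qed

lemma hcomp_zero_mult:
  assumes "x \<in> carrier R" "y \<in> carrier R"
  shows "hcomp 0 (x \<otimes> y) = hcomp 0 x \<otimes> hcomp 0 y"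
  using assms by (simp add: hcomp_mult)

lemma hcomp_mult_top:
  assumes "x \<in> carrier R" "y \<in> carrier R"
    and "\<And>i. i > m \<Longrightarrow> hcomp i x = \<zero>" "\<And>i. i > n \<Longrightarrow> hcomp i y = \<zero>"
  shows "hcomp (m + n) (x \<otimes> y) = hcomp m x \<otimes> hcomp n y"
proof -
  have "hcomp (m + n) (x \<otimes> y) = (\<Oplus>i\<in>{..m + n}. hcomp i x \<otimes> hcomp (m + n - i) y)"
    using assms by (rule_tac hcomp_mult)
  also have "\<dots> = (\<Oplus>i\<in>{..m + n}. if m = i then hcomp m x \<otimes> hcomp n y else \<zero>)"
  proof (rule add.finprod_cong')
    fix i assume "i \<in> {..m + n}"
    show "hcomp i x \<otimes> hcomp (m + n - i) y = (if m = i then hcomp m x \<otimes> hcomp n y else \<zero>)"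
    proof (cases i m rule: linorder_cases)
      case less
      then have "m + n - i > n" by auto
      then show ?thesis using assms less by auto
    qed (use assms in auto)
  qed (use assms in auto)
  also have "\<dots> = hcomp m x \<otimes> hcomp n y"
    using assms add.finprod_singleton[of m "{..m + n}" "\<lambda>i. hcomp m x \<otimes> hcomp n y"] by simp
  finally show ?thesis .
qed

text \<open>The degree-zero component of \<open>\<one>\<close> acts as an identity on every
  homogeneous element, hence on the whole ring, and so equals \<open>\<one>\<close>.\<close>

lemma one_homogeneous: "\<one> \<in> A 0"
proof -
  let ?e = "hcomp 0 \<one>"
  have e: "?e \<in> A 0" by (rule hcomp_A) simp
  have hom: "?e \<otimes> x = x" if "x \<in> A n" for x n
  proof -
    have "hcomp n (x \<otimes> \<one>) = x \<otimes> ?e"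
      using hcomp_mult_homogeneous[OF that, of \<one> n] by simp
    then show ?thesis using that e by (simp add: hcomp_self m_comm)
  qed
  have "?e \<otimes> x = x" if "x \<in> carrier R" for x
    using that
  proof (induction x rule: homogeneous_induct)
    case (homogeneous a n)
    then show ?case by (rule hom)
  next
    case (add x y)
    then show ?case using e by (simp add: r_distr)
  qed
  then have "?e = \<one>" using e by (metis A_carrier one_closed r_one)
  then show ?thesis using e by simp
qed

lemma A_pow: "a \<in> A n \<Longrightarrow> a [^] (k::nat) \<in> A (k * n)"
proof (induction k)
  case 0
  then show ?case using one_homogeneous by simp
next
  case (Suc k)
  then show ?case using A_mult[of "a [^] k" "k * n" a n] by (simp add: add.commute)
qed

lemma graded_ideal_iff:
  "graded_ideal R A J \<longleftrightarrow> ideal J R \<and> (\<forall>x\<in>J. \<forall>i. hcomp i x \<in> J)"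
  unfolding graded_ideal_def
  using hcomp_eq hcomp_decomposition ideal.Icarr by metis

lemma supp_top:
  assumes "x \<in> carrier R" "x \<noteq> \<zero>"
  obtains n where "hcomp n x \<noteq> \<zero>" "\<And>i. i > n \<Longrightarrow> hcomp i x = \<zero>"
proof
  have ne: "supp x \<noteq> {}" "finite (supp x)" using assms supp_empty_iff finite_supp by auto
  show "hcomp (Max (supp x)) x \<noteq> \<zero>" using Max_in[OF ne(2,1)] by (simp add: supp_def)
  fix i assume "i > Max (supp x)"
  then have "i \<notin> supp x" using ne(2) Max_ge leD by blast
  then show "hcomp i x = \<zero>" by (simp add: supp_def)
qed

lemma hcomp_hcomp: "x \<in> carrier R \<Longrightarrow> hcomp i (hcomp j x) = (if i = j then hcomp j x else \<zero>)"
  using hcomp_homogeneous[OF hcomp_A] by blast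

lemma supp_remove:
  assumes "x \<in> carrier R"
  shows "supp (x \<ominus> hcomp n x) = supp x - {n}"
proof -
  have "hcomp i (x \<ominus> hcomp n x) = (if i = n then \<zero> else hcomp i x)" for i
    using assms by (simp add: hcomp_diff hcomp_hcomp) (simp add: a_minus_def r_neg)
  then show ?thesis by (auto simp: supp_def)
qed

lemma card_supp_remove:
  assumes "x \<in> carrier R" "hcomp n x \<noteq> \<zero>"
  shows "card (supp (x \<ominus> hcomp n x)) < card (supp x)"
  unfolding supp_remove[OF assms(1)] using assms
  by (intro card_Diff1_less finite_supp) (auto simp: supp_def)

text \<open>Multiplying by a homogeneous element only shifts degrees and may kill components. The
  number of components is the induction measure in \<open>graded_saturation\<close>.\<close>

lemma card_supp_mult_homogeneous:
  assumes "a \<in> A n" "x \<in> carrier R"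
  shows "card (supp (a \<otimes> x)) \<le> card (supp x)"
proof -
  have "supp (a \<otimes> x) \<subseteq> (\<lambda>i. i + n) ` supp x"
  proof
    fix i assume "i \<in> supp (a \<otimes> x)"
    then have "hcomp i (a \<otimes> x) \<noteq> \<zero>" by (simp add: supp_def)
    then have "n \<le> i" "hcomp (i - n) x \<noteq> \<zero>"
      using hcomp_mult_homogeneous[OF assms, of i] assms by (auto split: if_splits)
    then show "i \<in> (\<lambda>i. i + n) ` supp x"
      by (auto simp: supp_def intro!: image_eqI[of _ _ "i - n"])
  qed
  then have "card (supp (a \<otimes> x)) \<le> card ((\<lambda>i. i + n) ` supp x)"
    using finite_supp[OF assms(2)] by (intro card_mono) auto
  also have "\<dots> \<le> card (supp x)" using finite_supp[OF assms(2)] by (rule card_image_le)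
  finally show ?thesis .
qed

end

section \<open>Chains, colon ideals and primes\<close>

text \<open>By Noetherianity a nonempty chain of ideals contains its own union, so Zorn's lemma
  applies inside any nonempty family.\<close>

lemma (in noetherian_ring) maximal_ideal_of_family:
  assumes "\<A> \<noteq> {}" "\<And>J. J \<in> \<A> \<Longrightarrow> ideal J R"
  shows "\<exists>M\<in>\<A>. \<forall>J\<in>\<A>. M \<subseteq> J \<longrightarrow> J = M"
proof (rule subset_Zorn_nonempty[OF assms(1)])
  show "\<Union>C \<in> \<A>" if C: "C \<noteq> {}" "subset.chain \<A> C" for C
  proof -
    have "subset.chain {J. ideal J R} C"
      using C(2) assms(2) unfolding pred_on.chain_def by auto
    then have "\<Union>C \<in> C" by (rule ideal_chain_is_trivial[OF C(1)])
    then show ?thesis using C(2) unfolding pred_on.chain_def by auto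
  qed
qed

lemma (in noetherian_ring) ascending_chain_stabilises:
  fixes L :: "nat \<Rightarrow> 'a set"
  assumes "\<And>n. ideal (L n) R" "\<And>n. L n \<subseteq> L (Suc n)"
  obtains N where "\<And>n. n \<ge> N \<Longrightarrow> L n = L N"
proof -
  have "\<exists>M\<in>range L. \<forall>J\<in>range L. M \<subseteq> J \<longrightarrow> J = M"
    using assms(1) by (intro maximal_ideal_of_family) auto
  then obtain N where N: "\<forall>n. L N \<subseteq> L n \<longrightarrow> L n = L N" by auto
  have "L n = L N" if "n \<ge> N" for n
    using lift_Suc_mono_le[of L, OF assms(2) that] N by simp
  then show ?thesis by (rule that)
qed

context cring
begin

lemma colon_ideal:
  assumes "ideal J R" "f \<in> carrier R"
  shows "ideal (colon R J f) R"
proof -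
  interpret J: ideal J R by fact
  show ?thesis
  proof (rule cring_ideal_by_closure)
    show "x \<oplus> y \<in> colon R J f" if "x \<in> colon R J f" "y \<in> colon R J f" for x y
      using that assms(2) J.a_closed[of "x \<otimes> f" "y \<otimes> f"] by (simp add: colon_def l_distr)
    show "r \<otimes> x \<in> colon R J f" if "r \<in> carrier R" "x \<in> colon R J f" for r x
      using that assms(2) J.I_l_closed[of "x \<otimes> f" r] by (simp add: colon_def m_assoc)
  qed (use assms(2) J.zero_closed in \<open>simp_all add: colon_def subset_iff\<close>)
qed

text \<open>Elements of the quotient are cosets \<open>J +> f\<close>, and \<open>r\<close> kills
  such a coset exactly when \<open>r \<otimes> f \<in> J\<close>; so annihilators are colon
  ideals.\<close>

lemma mem_Ass_iff:
  assumes "ideal J R"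
  shows "P \<in> Ass R J \<longleftrightarrow> primeideal P R \<and> (\<exists>f\<in>carrier R. colon R J f = P)"
proof -
  interpret J: ideal J R by fact
  have iff: "(J +> r) \<otimes>\<^bsub>R Quot J\<^esub> (J +> f) = \<zero>\<^bsub>R Quot J\<^esub> \<longleftrightarrow> r \<otimes> f \<in> J"
    if "r \<in> carrier R" "f \<in> carrier R" for r f
  proof -
    have "(J +> r) \<otimes>\<^bsub>R Quot J\<^esub> (J +> f) = J +> r \<otimes> f"
      using J.rcoset_mult_add[OF that] by (simp add: FactRing_def)
    moreover have "J +> r \<otimes> f = J \<longleftrightarrow> r \<otimes> f \<in> J"
    proof
      assume "J +> r \<otimes> f = J"
      then show "r \<otimes> f \<in> J" using that by (intro J.rcos_const_imp_mem) simp_all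
    qed (rule a_rcos_zero[OF assms])
    ultimately show ?thesis by (simp add: FactRing_def)
  qed
  have colon: "{r \<in> carrier R. (J +> r) \<otimes>\<^bsub>R Quot J\<^esub> (J +> f) = \<zero>\<^bsub>R Quot J\<^esub>} = colon R J f"
    if "f \<in> carrier R" for f
    unfolding colon_def using iff that by (intro Collect_cong conj_cong) simp_all
  have "carrier (R Quot J) = (\<lambda>f. J +> f) ` carrier R"
    unfolding FactRing_def A_RCOSETS_def' by auto
  then show ?thesis
    unfolding Ass_def by (simp add: colon eq_commute[of P])
qed

lemma subset_of_Ass:
  assumes "ideal J R" "P \<in> Ass R J"
  shows "J \<subseteq> P"
  using assms by (auto simp: mem_Ass_iff colon_def ideal.I_r_closed ideal.Icarr)

text \<open>Zorn's lemma is applied to complements of primes, so that the union of a chain of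
  complements corresponds to the intersection of a chain of primes, which is again prime.\<close>

lemma minimal_prime_exists:
  assumes "primeideal Q R" "J \<subseteq> Q"
  shows "Min_primes R J \<noteq> {}"
proof -
  let ?\<A> = "{carrier R - P | P. primeideal P R \<and> J \<subseteq> P}"
  have chain: "\<Union>C \<in> ?\<A>" if C: "C \<noteq> {}" "subset.chain ?\<A> C" for C
  proof -
    have sub: "C \<subseteq> ?\<A>" and lin: "\<And>U V. U \<in> C \<Longrightarrow> V \<in> C \<Longrightarrow> U \<subseteq> V \<or> V \<subseteq> U"
      using C(2) by (simp_all add: subset_chain_def)
    define P where "P = carrier R - \<Union>C"
    have prime: "primeideal (carrier R - U) R" "J \<subseteq> carrier R - U" "U \<subseteq> carrier R" if U: "U \<in> C" for U
    proof -
      obtain P' where P': "U = carrier R - P'" "primeideal P' R" "J \<subseteq> P'" using U sub by auto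
      then have "P' \<subseteq> carrier R"
        using additive_subgroup.a_subset[OF ideal.axioms(1)[OF primeideal.axioms(1)]] by auto
      then have "carrier R - U = P'" using P' by auto
      then show "primeideal (carrier R - U) R" "J \<subseteq> carrier R - U" "U \<subseteq> carrier R" using P' by auto
    qed
    have id: "ideal (carrier R - U) R" if "U \<in> C" for U
      using prime(1)[OF that] by (rule primeideal.axioms)
    obtain U0 where U0: "U0 \<in> C" using C(1) by auto
    have "primeideal P R"
    proof (rule primeidealI)
      show "ideal P R"
      proof (rule cring_ideal_by_closure)
        show "P \<subseteq> carrier R" by (auto simp: P_def)
        show "\<zero> \<in> P" using id by (auto simp: P_def dest: ideal.axioms(1) additive_subgroup.zero_closed)
        show "x \<oplus> y \<in> P" if "x \<in> P" "y \<in> P" for x y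
          using that additive_subgroup.a_closed[OF ideal.axioms(1)[OF id], of _ x y]
          by (auto simp: P_def)
        show "r \<otimes> x \<in> P" if "r \<in> carrier R" "x \<in> P" for r x
          using that ideal.I_l_closed[OF id, of _ x r] by (auto simp: P_def)
      qed
      show "cring R" by (rule is_cring)
      have "\<one> \<notin> carrier R - U0"
        using primeideal.I_notcarr[OF prime(1)[OF U0]] ideal.one_imp_carrier[OF id[OF U0]] by auto
      then show "carrier R \<noteq> P" using U0 by (auto simp: P_def)
      fix a b assume ab: "a \<in> carrier R" "b \<in> carrier R" "a \<otimes> b \<in> P"
      show "a \<in> P \<or> b \<in> P"
      proof (rule ccontr)
        assume "\<not> (a \<in> P \<or> b \<in> P)"
        then obtain U V where "U \<in> C" "a \<in> U" "V \<in> C" "b \<in> V" using ab by (auto simp: P_def)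
        \<comment> \<open>The larger of the two chain members contains both \<open>a\<close> and
          \<open>b\<close>; its complement is a prime avoiding both, hence avoiding their
          product.\<close>
        then obtain W where W: "W \<in> C" "a \<in> W" "b \<in> W" using lin by blast
        then have "a \<otimes> b \<notin> carrier R - W" using primeideal.I_prime[OF prime(1)[OF W(1)]] ab by blast
        then show False using ab W by (auto simp: P_def)
      qed
    qed
    moreover have "J \<subseteq> P" using prime(2) U0 by (auto simp: P_def)
    moreover have "\<Union>C = carrier R - P" using prime(3) by (auto simp: P_def)
    ultimately show ?thesis by blast
  qed
  have "?\<A> \<noteq> {}" using assms by blast
  then have "\<exists>M\<in>?\<A>. \<forall>U\<in>?\<A>. M \<subseteq> U \<longrightarrow> U = M" by (rule subset_Zorn_nonempty) (rule chain)
  then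
  obtain M where M: "M \<in> ?\<A>" "\<forall>U\<in>?\<A>. M \<subseteq> U \<longrightarrow> U = M" by (elim bexE)
  then obtain P where P: "M = carrier R - P" "primeideal P R" "J \<subseteq> P" by auto
  have "Q' = P" if Q': "primeideal Q' R" "J \<subseteq> Q'" "Q' \<subseteq> P" for Q'
  proof -
    have "carrier R - Q' \<in> ?\<A>" "M \<subseteq> carrier R - Q'" using P Q' by auto
    from M(2)[rule_format, OF this] have "carrier R - Q' = carrier R - P" unfolding P(1) .
    moreover have "P \<subseteq> carrier R" "Q' \<subseteq> carrier R"
      using additive_subgroup.a_subset[OF ideal.axioms(1)[OF primeideal.axioms(1)]] P(2) Q'(1) by auto
    ultimately show ?thesis by blast
  qed
  then show ?thesis using P by (auto simp: Min_primes_def)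
qed

lemma prime_power_mem:
  assumes "primeideal P R" "x \<in> carrier R" "x [^] (k::nat) \<in> P"
  shows "x \<in> P"
  using assms(3)
proof (induction k)
  case 0
  then show ?case
    using assms(1) primeideal.I_notcarr ideal.one_imp_carrier primeideal.axioms(1) by fastforce
next
  case (Suc k)
  then show ?case using primeideal.I_prime[OF assms(1), of "x [^] k" x] assms(2) by auto
qed

section \<open>Powers of an ideal\<close>

abbreviation ideal_pow :: "'a set \<Rightarrow> nat \<Rightarrow> 'a set" where
  "ideal_pow I k \<equiv> I [^]\<^bsub>ideals_set R\<^esub> k"

lemma monoid_ideals_set: "Group.monoid (ideals_set R)"
  using ideals_set_is_comm_monoid by (rule comm_monoid.axioms)

lemma ideals_set_simps [simp]:
  "I \<in> carrier (ideals_set R) \<longleftrightarrow> ideal I R"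
  "I \<otimes>\<^bsub>ideals_set R\<^esub> J = I \<cdot> J"
  "\<one>\<^bsub>ideals_set R\<^esub> = carrier R"
  by (simp_all add: ideals_set_def)

lemma ideal_pow_0 [simp]: "ideal_pow I 0 = carrier R"
  using monoid.nat_pow_0[OF monoid_ideals_set] by simp

lemma ideal_pow_Suc: "ideal_pow I (Suc k) = ideal_pow I k \<cdot> I"
  using monoid.nat_pow_Suc[OF monoid_ideals_set] by simp

lemma ideal_pow_ideal: "ideal I R \<Longrightarrow> ideal (ideal_pow I k) R"
  using monoid.nat_pow_closed[OF monoid_ideals_set] by simp

lemma ideal_pow_mult:
  assumes "ideal I R" "x \<in> ideal_pow I a" "y \<in> ideal_pow I b"
  shows "x \<otimes> y \<in> ideal_pow I (a + b)"
  using monoid.nat_pow_mult[OF monoid_ideals_set, of I a b] assms ideal_prod.prod[OF assms(2,3), of R]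
  by simp

lemma ideal_pow_Suc_subset: "ideal I R \<Longrightarrow> ideal_pow I (Suc k) \<subseteq> ideal_pow I k"
  using ideal_prod_inter ideal_pow_ideal unfolding ideal_pow_Suc by blast

lemma ideal_pow_1: "ideal I R \<Longrightarrow> ideal_pow I 1 = I"
  using ideal_pow_Suc[of I 0] ideal_prod_one ideal_prod_commute[OF oneideal] by simp

end

section \<open>Graded ideals and primes\<close>

lemma (in ideal) finsum_mem:
  assumes "\<And>i. i \<in> F \<Longrightarrow> f i \<in> I"
  shows "(\<Oplus>i\<in>F. f i) \<in> I"
  using assms
proof (induction F rule: infinite_finite_induct)
  case (insert i F)
  have "f i \<in> carrier R" "f \<in> F \<rightarrow> carrier R" using insert.prems Icarr by auto
  then have "(\<Oplus>j\<in>insert i F. f j) = f i \<oplus> (\<Oplus>j\<in>F. f j)"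
    by (intro finsum_insert insert.hyps)
  then show ?case using insert.prems insert.IH by simp
qed simp_all

lemma (in ideal) minus_mem_iff:
  assumes "x \<in> I" "y \<in> carrier R"
  shows "y \<ominus> x \<in> I \<longleftrightarrow> y \<in> I"
proof
  have x: "x \<in> carrier R" using assms Icarr by simp
  assume "y \<ominus> x \<in> I"
  then have "(y \<ominus> x) \<oplus> x \<in> I" using assms by simp
  moreover have "(y \<ominus> x) \<oplus> x = y" using x assms by (simp add: a_minus_def a_assoc l_neg)
  ultimately show "y \<in> I" by simp
next
  assume "y \<in> I"
  then show "y \<ominus> x \<in> I" using assms by (simp add: a_minus_def)
qed

context graded_cring
begin

lemma graded_idealD:
  assumes "graded_ideal R A J"
  shows "ideal J R" "x \<in> J \<Longrightarrow> hcomp i x \<in> J"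
  using assms by (simp_all add: graded_ideal_iff)

lemma graded_carrier: "graded_ideal R A (carrier R)"
  by (simp add: graded_ideal_iff oneideal)

text \<open>The product of the top components of \<open>a\<close> and \<open>b\<close> is a
  component of \<open>a \<otimes> b\<close>, so it lies in \<open>Q\<close>. One of the two top
  components is then in \<open>Q\<close> and can be subtracted; induction on the number of nonzero
  components finishes.\<close>

lemma graded_prime_criterion:
  assumes Q: "graded_ideal R A Q" and proper: "carrier R \<noteq> Q"
    and hom: "\<And>i j a b. a \<in> A i \<Longrightarrow> b \<in> A j \<Longrightarrow> a \<otimes> b \<in> Q \<Longrightarrow> a \<in> Q \<or> b \<in> Q"
  shows "primeideal Q R"
proof (rule primeidealI)
  show "ideal Q R" by (rule graded_idealD[OF Q])
  interpret Q: ideal Q R by fact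
  show "cring R" by (rule is_cring)
  show "a \<in> Q \<or> b \<in> Q" if "a \<in> carrier R" "b \<in> carrier R" "a \<otimes> b \<in> Q" for a b
    using that
  proof (induction "card (supp a) + card (supp b)" arbitrary: a b rule: less_induct)
    case less
    note a = less.prems(1) and b = less.prems(2) and ab = less.prems(3)
    show ?case
    proof (cases "a = \<zero> \<or> b = \<zero>")
      case False
      then obtain m n where m: "hcomp m a \<noteq> \<zero>" "\<And>i. i > m \<Longrightarrow> hcomp i a = \<zero>"
        and n: "hcomp n b \<noteq> \<zero>" "\<And>i. i > n \<Longrightarrow> hcomp i b = \<zero>"
        using supp_top a b by metis
      have "hcomp m a \<otimes> hcomp n b \<in> Q"
        using hcomp_mult_top[OF a b m(2) n(2)] graded_idealD(2)[OF Q ab, of "m + n"] by simp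
      then consider "hcomp m a \<in> Q" | "hcomp n b \<in> Q" using hom hcomp_A a b by metis
      then show ?thesis
      proof cases
        case 1
        have "(a \<ominus> hcomp m a) \<otimes> b = a \<otimes> b \<ominus> hcomp m a \<otimes> b"
          using a b by (simp add: a_minus_def l_distr l_minus)
        then have "(a \<ominus> hcomp m a) \<otimes> b \<in> Q"
          using ab 1 a b by (simp add: Q.minus_mem_iff Q.I_r_closed)
        then have "a \<ominus> hcomp m a \<in> Q \<or> b \<in> Q"
          using less.hyps[of "a \<ominus> hcomp m a" b] card_supp_remove[OF a m(1)] a b by simp
        then show ?thesis using 1 a by (simp add: Q.minus_mem_iff)
      next
        case 2
        have "a \<otimes> (b \<ominus> hcomp n b) = a \<otimes> b \<ominus> a \<otimes> hcomp n b"
          using a b by (simp add: a_minus_def r_distr r_minus)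
        then have "a \<otimes> (b \<ominus> hcomp n b) \<in> Q"
          using ab 2 a b by (simp add: Q.minus_mem_iff Q.I_l_closed)
        then have "a \<in> Q \<or> b \<ominus> hcomp n b \<in> Q"
          using less.hyps[of a "b \<ominus> hcomp n b"] card_supp_remove[OF b n(1)] a b by simp
        then show ?thesis using 2 b by (simp add: Q.minus_mem_iff)
      qed
    qed auto
  qed
qed (use proper in simp)

lemma graded_colon:
  assumes J: "graded_ideal R A J" and g: "g \<in> A d"
  shows "graded_ideal R A (colon R J g)"
  unfolding graded_ideal_iff
proof (intro conjI ballI allI)
  show "ideal (colon R J g) R" using colon_ideal graded_idealD(1)[OF J] g by simp
  fix x i assume x: "x \<in> colon R J g"
  then have "hcomp (i + d) (g \<otimes> x) \<in> J"
    using graded_idealD(2)[OF J, of "x \<otimes> g" "i + d"] A_carrier[OF g] m_comm[of x g]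
    by (simp add: colon_def)
  then show "hcomp i x \<in> colon R J g"
    using x g hcomp_mult_homogeneous[OF g, of x "i + d"] by (simp add: colon_def m_comm)
qed

text \<open>Although \<open>P\<close> itself need not be graded, the elements killed by something outside \<open>P\<close> are
  already killed by something homogeneous outside \<open>P\<close>.\<close>

lemma graded_saturation:
  assumes P: "primeideal P R" and J: "graded_ideal R A J"
  shows "graded_ideal R A {r \<in> carrier R. \<exists>s\<in>carrier R - P. s \<otimes> r \<in> J}"
proof -
  interpret P: primeideal P R by fact
  interpret J: ideal J R by (rule graded_idealD[OF J])
  \<comment> \<open>The same set with homogeneous multipliers only. Gradedness is immediate for
    \<open>K\<close>; the work lies in showing that arbitrary multipliers give nothing more.\<close>
  define K where "K = {r \<in> carrier R. \<exists>d. \<exists>h\<in>A d - P. h \<otimes> r \<in> J}"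
  have one: "\<one> \<in> A 0 - P"
    using one_homogeneous P.I_notcarr P.one_imp_carrier by auto
  have mult: "g \<otimes> h \<in> A (d + e) - P" if "g \<in> A d - P" "h \<in> A e - P" for g h d e
    using that A_mult P.I_prime[of g h] by auto
  have idK: "ideal K R"
  proof (rule cring_ideal_by_closure)
    show "K \<subseteq> carrier R" by (auto simp: K_def)
    show "\<zero> \<in> K" using one unfolding K_def by (intro CollectI conjI exI[of _ 0] bexI[of _ \<one>]) auto
  next
    fix x y assume "x \<in> K" "y \<in> K"
    then obtain g h d e where *: "x \<in> carrier R" "y \<in> carrier R" "g \<in> A d - P" "h \<in> A e - P"
      "g \<otimes> x \<in> J" "h \<otimes> y \<in> J" unfolding K_def by blast
    then have gh: "g \<in> carrier R" "h \<in> carrier R" by auto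
    have "(g \<otimes> h) \<otimes> (x \<oplus> y) = h \<otimes> (g \<otimes> x) \<oplus> g \<otimes> (h \<otimes> y)"
      using *(1,2) gh by (simp add: r_distr m_ac)
    also have "\<dots> \<in> J" using *(5,6) gh by (simp add: J.I_l_closed)
    finally show "x \<oplus> y \<in> K"
      using mult[OF *(3,4)] *(1,2) unfolding K_def by (intro CollectI conjI exI bexI) auto
  next
    fix r x assume r: "r \<in> carrier R" and "x \<in> K"
    then obtain h d where *: "x \<in> carrier R" "h \<in> A d - P" "h \<otimes> x \<in> J" unfolding K_def by blast
    then have "h \<in> carrier R" by auto
    then have "h \<otimes> (r \<otimes> x) = r \<otimes> (h \<otimes> x)" using * r by (simp add: m_ac)
    also have "\<dots> \<in> J" using * r by (simp add: J.I_l_closed)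
    finally show "r \<otimes> x \<in> K"
      using *(1,2) r unfolding K_def by (intro CollectI conjI exI bexI) auto
  qed
  interpret K: ideal K R by (rule idK)
  have graded: "hcomp i x \<in> K" if x: "x \<in> K" for x i
  proof -
    obtain h d where *: "x \<in> carrier R" "h \<in> A d - P" "h \<otimes> x \<in> J" using x unfolding K_def by blast
    have "h \<otimes> hcomp i x \<in> J"
      using graded_idealD(2)[OF J *(3), of "i + d"] hcomp_mult_homogeneous[of h d x "i + d"] * by simp
    then show ?thesis using * unfolding K_def by (intro CollectI conjI exI bexI) auto
  qed
  \<comment> \<open>The leading component \<open>st\<close> of \<open>s\<close> carries
    \<open>r\<close> into \<open>K\<close>. If \<open>st\<close> lies outside \<open>P\<close>, it
    is a homogeneous multiplier; otherwise \<open>s \<ominus> st\<close> is still outside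
    \<open>P\<close> and has fewer components, so induction applies.\<close>
  have key: "r \<in> K" if "s \<in> carrier R - P" "r \<in> carrier R" "s \<otimes> r \<in> K" for s r
    using that
  proof (induction "card (supp s) + card (supp r)" arbitrary: s r rule: less_induct)
    case less
    have s: "s \<in> carrier R" "s \<notin> P" and r: "r \<in> carrier R" and sr: "s \<otimes> r \<in> K"
      using less.prems by auto
    show ?case
    proof (cases "r = \<zero>")
      case False
      have "s \<noteq> \<zero>" using s P.zero_closed by metis
      then obtain t n where t: "hcomp t s \<noteq> \<zero>" "\<And>i. i > t \<Longrightarrow> hcomp i s = \<zero>"
        and n: "hcomp n r \<noteq> \<zero>" "\<And>i. i > n \<Longrightarrow> hcomp i r = \<zero>"
        using supp_top s(1) r False by metis
      define st rn where "st = hcomp t s" and "rn = hcomp n r"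
      have stA: "st \<in> A t" and st: "st \<in> carrier R" and rn: "rn \<in> carrier R"
        using s r hcomp_A by (auto simp: st_def rn_def)
      have top: "st \<otimes> rn \<in> K"
        using hcomp_mult_top[OF s(1) r t(2) n(2)] graded[OF sr, of "t + n"]
        by (simp add: st_def rn_def)
      \<comment> \<open>Subtracting \<open>rn\<close> from \<open>r\<close> alone is not enough,
        since only \<open>st \<otimes> rn\<close>, not \<open>s \<otimes> rn\<close>, is known to
        lie in \<open>K\<close>; the extra factor \<open>st\<close> repairs this without adding
        components.\<close>
      define r' where "r' = st \<otimes> (r \<ominus> rn)"
      have r': "r' \<in> carrier R" using st r rn by (simp add: r'_def)
      have "s \<otimes> r' = st \<otimes> (s \<otimes> r) \<ominus> s \<otimes> (st \<otimes> rn)"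
        using s st r rn by (simp add: r'_def a_minus_def r_distr r_minus m_ac)
      then have "s \<otimes> r' \<in> K"
        using top sr s st r rn by (simp add: K.minus_mem_iff K.I_l_closed)
      moreover have "card (supp r') < card (supp r)"
        using card_supp_mult_homogeneous[OF stA, of "r \<ominus> rn"] card_supp_remove[OF r n(1)] r rn
        by (simp add: r'_def rn_def)
      ultimately have "r' \<in> K" using less.hyps[of s r'] s r' by simp
      moreover have "r' = st \<otimes> r \<ominus> st \<otimes> rn"
        using st r rn by (simp add: r'_def a_minus_def r_distr r_minus)
      ultimately have str: "st \<otimes> r \<in> K" using top K.minus_mem_iff[OF top] st r by simp
      show ?thesis
      proof (cases "st \<in> P")
        case True
        have "(s \<ominus> st) \<otimes> r = s \<otimes> r \<ominus> st \<otimes> r"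
          using s st r by (simp add: a_minus_def l_distr l_minus)
        then have "(s \<ominus> st) \<otimes> r \<in> K" using str sr s r by (simp add: K.minus_mem_iff)
        moreover have "s \<ominus> st \<in> carrier R - P" using True s st by (simp add: P.minus_mem_iff)
        moreover have "card (supp (s \<ominus> st)) < card (supp s)"
          unfolding st_def by (rule card_supp_remove[OF s(1) t(1)])
        ultimately show ?thesis using less.hyps[of "s \<ominus> st" r] r by simp
      next
        case False
        obtain h d where h: "h \<in> A d - P" "h \<otimes> (st \<otimes> r) \<in> J" using str unfolding K_def by blast
        then have "h \<in> carrier R" by auto
        then have "(h \<otimes> st) \<otimes> r \<in> J" using h(2) st r by (simp add: m_assoc)
        moreover have "h \<otimes> st \<in> A (d + t) - P" using mult[OF h(1)] stA False by simp
        ultimately show ?thesis using r unfolding K_def by (intro CollectI conjI exI bexI) auto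
      qed
    qed simp
  qed
  have "{r \<in> carrier R. \<exists>s\<in>carrier R - P. s \<otimes> r \<in> J} = K"
  proof (intro equalityI subsetI)
    fix r assume "r \<in> {r \<in> carrier R. \<exists>s\<in>carrier R - P. s \<otimes> r \<in> J}"
    then obtain s where s: "r \<in> carrier R" "s \<in> carrier R - P" "s \<otimes> r \<in> J" by blast
    then have "s \<otimes> r \<in> K" using one unfolding K_def by (intro CollectI conjI exI[of _ 0] bexI[of _ \<one>]) auto
    then show "r \<in> K" using key s by blast
  next
    fix r assume "r \<in> K"
    then show "r \<in> {r \<in> carrier R. \<exists>s\<in>carrier R - P. s \<otimes> r \<in> J}"
      unfolding K_def using A_carrier by blast
  qed
  then show ?thesis using idK graded by (simp add: graded_ideal_iff)
qed

lemma graded_ideal_prod: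
  assumes I: "graded_ideal R A I" and J: "graded_ideal R A J"
  shows "graded_ideal R A (I \<cdot> J)"
  unfolding graded_ideal_iff
proof (intro conjI ballI allI)
  show id: "ideal (I \<cdot> J) R" using ideal_prod_is_ideal graded_idealD(1)[OF I] graded_idealD(1)[OF J] .
  fix x n assume "x \<in> I \<cdot> J"
  then show "hcomp n x \<in> I \<cdot> J"
  proof (induction x rule: ideal_prod.induct)
    case (prod i j)
    then have "i \<in> carrier R" "j \<in> carrier R"
      using ideal.Icarr graded_idealD(1)[OF I] graded_idealD(1)[OF J] by metis+
    moreover have "(\<Oplus>p\<in>{..n}. hcomp p i \<otimes> hcomp (n - p) j) \<in> I \<cdot> J"
      using prod graded_idealD(2)[OF I] graded_idealD(2)[OF J]
      by (intro ideal.finsum_mem[OF id] ideal_prod.prod)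
    ultimately show ?case by (simp add: hcomp_mult)
  next
    case (sum u v)
    then have "u \<in> carrier R" "v \<in> carrier R" using ideal.Icarr[OF id] by auto
    then show ?case using sum.IH by (simp add: hcomp_add ideal_prod.sum)
  qed
qed

lemma graded_ideal_pow: "graded_ideal R A I \<Longrightarrow> graded_ideal R A (ideal_pow I k)"
  by (induction k) (simp_all add: graded_carrier ideal_pow_Suc graded_ideal_prod)

end

locale graded_noetherian_domain = graded_cring R A + noetherian_domain R
  for R (structure) and A
begin

text \<open>A colon ideal maximal among those of homogeneous elements outside \<open>J\<close> is
  prime. By \<open>graded_prime_criterion\<close> only homogeneous factors matter, and for such a
  \<open>b\<close> outside the ideal, \<open>b \<otimes> g\<close> yields another member of the
  family, containing the first and so equal to it.\<close>

lemma homogeneous_associated_prime: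
  assumes J: "graded_ideal R A J" and proper: "J \<noteq> carrier R"
  obtains g d where "g \<in> A d" "primeideal (colon R J g) R"
proof -
  interpret J: ideal J R by (rule graded_idealD[OF J])
  let ?\<A> = "{colon R J g | g d. g \<in> A d \<and> g \<notin> J}"
  have "\<one> \<in> A 0 \<and> \<one> \<notin> J" using one_homogeneous J.one_imp_carrier proper by auto
  then have ne: "?\<A> \<noteq> {}" by blast
  have id: "ideal K R" if "K \<in> ?\<A>" for K
    using that colon_ideal[OF J.is_ideal] A_carrier by blast
  have "\<exists>M\<in>?\<A>. \<forall>K\<in>?\<A>. M \<subseteq> K \<longrightarrow> K = M"
    using ne by (rule maximal_ideal_of_family) (rule id)
  then obtain M where M: "M \<in> ?\<A>" "\<forall>K\<in>?\<A>. M \<subseteq> K \<longrightarrow> K = M" by (elim bexE)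
  then obtain g d where g: "M = colon R J g" "g \<in> A d" "g \<notin> J" by auto
  have "primeideal M R"
  proof (rule graded_prime_criterion)
    show "graded_ideal R A M" unfolding g(1) by (rule graded_colon[OF J g(2)])
    have "\<one> \<notin> M" using g by (simp add: colon_def)
    then show "carrier R \<noteq> M" by auto
    fix i j a b assume a: "a \<in> A i" and b: "b \<in> A j" and ab: "a \<otimes> b \<in> M"
    have bg: "b \<otimes> g \<in> A (j + d)" using b g by (simp add: A_mult)
    show "a \<in> M \<or> b \<in> M"
    proof (cases "b \<in> M")
      case False
      then have "b \<otimes> g \<notin> J" using b g by (simp add: colon_def)
      then have "colon R J (b \<otimes> g) \<in> ?\<A>" using bg by blast
      moreover have "M \<subseteq> colon R J (b \<otimes> g)"
      proof
        fix r assume "r \<in> M"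
        then have r: "r \<in> carrier R" "r \<otimes> g \<in> J" by (simp_all add: g(1) colon_def)
        have "r \<otimes> (b \<otimes> g) = b \<otimes> (r \<otimes> g)" using r b g by (simp add: m_ac)
        also have "\<dots> \<in> J" using r b by (simp add: J.I_l_closed)
        finally show "r \<in> colon R J (b \<otimes> g)" using r by (simp add: colon_def)
      qed
      ultimately have "colon R J (b \<otimes> g) = M" using M(2)[rule_format] by simp
      moreover have "a \<in> colon R J (b \<otimes> g)"
        using ab a b g by (simp add: g(1) colon_def m_assoc)
      ultimately show ?thesis by simp
    qed simp
  qed
  then show ?thesis using that g by simp
qed

end

section \<open>Graded filtrations and symbolic powers\<close>

text \<open>The properties of symbolic powers on which the asymptotics rest; both conventions are
  treated at once through this abstraction.\<close>

locale graded_filtration = graded_noetherian_domain R A for R (structure) and A +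
  fixes J :: "nat \<Rightarrow> 'a set"
  assumes graded_J: "graded_ideal R A (J k)"
    and J_0: "J 0 = carrier R"
    and J_mult: "x \<in> J a \<Longrightarrow> y \<in> J b \<Longrightarrow> x \<otimes> y \<in> J (a + b)"
    and J_Suc: "J (Suc k) \<subseteq> J k"
    and J_1_proper: "J 1 \<noteq> carrier R"
    and J_1_nonzero: "J 1 \<noteq> {\<zero>}"
begin

lemma J_ideal: "ideal (J k) R"
  by (rule graded_idealD[OF graded_J])

lemma J_carrier [simp]: "x \<in> J k \<Longrightarrow> x \<in> carrier R"
  by (rule ideal.Icarr[OF J_ideal])

lemma J_zero [simp]: "\<zero> \<in> J k"
  using additive_subgroup.zero_closed ideal.axioms(1)[OF J_ideal] by fast

lemma J_antimono: "a \<le> b \<Longrightarrow> J b \<subseteq> J a"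
  using lift_Suc_antimono_le[of J] J_Suc by simp

lemma J_hcomp: "x \<in> J k \<Longrightarrow> hcomp i x \<in> J k"
  by (rule graded_idealD[OF graded_J])

text \<open>The inclusion \<open>J k \<subseteq> split D k\<close> for all \<open>k \<ge> 1\<close>
  expresses that the Rees algebra is generated in \<open>t\<close>-degrees at most \<open>D\<close>.
  The value \<open>i = k\<close> is allowed, so for \<open>1 \<le> k \<le> D\<close> the inclusion
  is immediate from \<open>J 0 = carrier R\<close>.\<close>

definition split :: "nat \<Rightarrow> nat \<Rightarrow> 'a set" where
  "split D k = Idl {a \<otimes> b | a b i. 1 \<le> i \<and> i \<le> D \<and> i \<le> k \<and> a \<in> J i \<and> b \<in> J (k - i)}"

lemma split_ideal: "ideal (split D k) R"
  unfolding split_def by (rule genideal_ideal) auto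

lemma split_intro:
  assumes "1 \<le> i" "i \<le> D" "i \<le> k" "a \<in> J i" "b \<in> J (k - i)"
  shows "a \<otimes> b \<in> split D k"
  unfolding split_def using assms by (intro set_mp[OF genideal_self]) auto

lemma split_minimal:
  assumes "ideal K R"
    and "\<And>a b i. 1 \<le> i \<Longrightarrow> i \<le> D \<Longrightarrow> i \<le> k \<Longrightarrow> a \<in> J i \<Longrightarrow> b \<in> J (k - i) \<Longrightarrow> a \<otimes> b \<in> K"
  shows "split D k \<subseteq> K"
  unfolding split_def using assms by (intro genideal_minimal) auto

text \<open>Multiplicativity of \<open>J\<close> moves \<open>x\<close> onto the second factor of
  each generator. This lets \<open>split D\<close> serve as the coefficient family of an ideal of
  the Rees algebra.\<close>

lemma split_mult:
  assumes x: "x \<in> J i" and y: "y \<in> split D m"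
  shows "x \<otimes> y \<in> split D (i + m)"
proof -
  have "split D m \<subseteq> colon R (split D (i + m)) x"
  proof (rule split_minimal)
    show "ideal (colon R (split D (i + m)) x) R" using x by (intro colon_ideal split_ideal) simp
    fix a b j assume *: "1 \<le> j" "j \<le> D" "j \<le> m" "a \<in> J j" "b \<in> J (m - j)"
    then have "a \<otimes> (x \<otimes> b) \<in> split D (i + m)"
      using J_mult[OF x, of b "m - j"] by (intro split_intro[of j]) simp_all
    moreover have "a \<otimes> (x \<otimes> b) = (a \<otimes> b) \<otimes> x" using * x by (simp add: m_ac)
    ultimately show "a \<otimes> b \<in> colon R (split D (i + m)) x" using * by (simp add: colon_def)
  qed
  then have "y \<in> carrier R" "y \<otimes> x \<in> split D (i + m)" using y by (auto simp: colon_def)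
  then show ?thesis using x by (simp add: m_comm)
qed

text \<open>The ideal of polynomials without constant term is finitely generated; \<open>D\<close>
  bounds the degrees of its generators. These have coefficients in \<open>split D\<close>, and since
  that condition defines an ideal, so has every element.\<close>

lemma Rees_noetherian_split:
  assumes noeth: "noetherian_ring
    ((UP R)\<lparr>carrier := {p \<in> carrier (UP R). \<forall>k. up_ring.coeff (UP R) p k \<in> J k}\<rparr>)"
  obtains D where "\<And>k. k \<ge> 1 \<Longrightarrow> J k \<subseteq> split D k"
proof -
  define U where "U = {p \<in> up R. \<forall>k. p k \<in> J k}"
  define S where "S = (UP R)\<lparr>carrier := U\<rparr>"
  have "{p \<in> carrier (UP R). \<forall>k. up_ring.coeff (UP R) p k \<in> J k} = U"
    by (auto simp: U_def UP_def)
  then interpret S: noetherian_ring S using noeth by (simp add: S_def)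
  have carrier_S: "carrier S = U" by (simp add: S_def)
  have zero_S: "\<zero>\<^bsub>S\<^esub> = (\<lambda>i. \<zero>)" by (simp add: S_def UP_def)
  have U_up: "p \<in> U \<Longrightarrow> p \<in> up R" and UJ: "p \<in> U \<Longrightarrow> p k \<in> J k" for p k by (auto simp: U_def)
  have add_S: "p \<oplus>\<^bsub>S\<^esub> q = (\<lambda>i. p i \<oplus> q i)" if "p \<in> U" "q \<in> U" for p q
    using that U_up by (simp add: S_def UP_def)
  have mult_S: "p \<otimes>\<^bsub>S\<^esub> q = (\<lambda>n. \<Oplus>i\<in>{..n}. p i \<otimes> q (n - i))" if "p \<in> U" "q \<in> U" for p q
    using that U_up by (simp add: S_def UP_def)
  \<comment> \<open>Coefficientwise membership in \<open>N\<close> defines an ideal as soon as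
    \<open>N\<close> absorbs multiplication by \<open>J\<close>; used for \<open>P\<close> and for
    the condition given by \<open>split D\<close>.\<close>
  have ideal_S: "ideal {p \<in> U. \<forall>k. p k \<in> N k} S"
    if N: "\<And>k. ideal (N k) R" and NJ: "\<And>i m x y. x \<in> J i \<Longrightarrow> y \<in> N m \<Longrightarrow> x \<otimes> y \<in> N (i + m)"
    for N
  proof (rule S.ideal_by_closure)
    show "{p \<in> U. \<forall>k. p k \<in> N k} \<subseteq> carrier S" by (auto simp: carrier_S)
    show "\<zero>\<^bsub>S\<^esub> \<in> {p \<in> U. \<forall>k. p k \<in> N k}"
      using S.zero_closed additive_subgroup.zero_closed[OF ideal.axioms(1)[OF N]]
      by (simp add: carrier_S zero_S)
  next
    fix p q assume pq: "p \<in> {p \<in> U. \<forall>k. p k \<in> N k}" "q \<in> {p \<in> U. \<forall>k. p k \<in> N k}"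
    then have "p \<oplus>\<^bsub>S\<^esub> q \<in> U" using S.a_closed by (simp add: carrier_S)
    then show "p \<oplus>\<^bsub>S\<^esub> q \<in> {p \<in> U. \<forall>k. p k \<in> N k}"
      using pq additive_subgroup.a_closed[OF ideal.axioms(1)[OF N]] by (simp add: add_S)
  next
    fix h p assume "h \<in> carrier S" "p \<in> {p \<in> U. \<forall>k. p k \<in> N k}"
    then have h: "h \<in> U" and p: "p \<in> U" "\<And>k. p k \<in> N k" by (simp_all add: carrier_S)
    have mem: "h i \<otimes> p (n - i) \<in> N n" if "i \<le> n" for i n
      using NJ[OF UJ[OF h] p(2), of i "n - i"] that by simp
    have "h \<otimes>\<^bsub>S\<^esub> p \<in> U" "p \<otimes>\<^bsub>S\<^esub> h \<in> U" using S.m_closed h p(1) by (simp_all add: carrier_S)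
    moreover have "(h \<otimes>\<^bsub>S\<^esub> p) n \<in> N n" for n
      unfolding mult_S[OF h p(1)] using mem by (intro ideal.finsum_mem[OF N]) simp
    moreover have "(p \<otimes>\<^bsub>S\<^esub> h) n \<in> N n" for n
      unfolding mult_S[OF p(1) h]
    proof (intro ideal.finsum_mem[OF N])
      fix i assume "i \<in> {..n}"
      then have "p i \<otimes> h (n - i) = h (n - i) \<otimes> p (n - (n - i))"
        using J_carrier[OF UJ[OF p(1)]] J_carrier[OF UJ[OF h]] by (simp add: m_comm)
      also have "\<dots> \<in> N n" by (rule mem) simp
      finally show "p i \<otimes> h (n - i) \<in> N n" .
    qed
    ultimately show "h \<otimes>\<^bsub>S\<^esub> p \<in> {p \<in> U. \<forall>k. p k \<in> N k}" "p \<otimes>\<^bsub>S\<^esub> h \<in> {p \<in> U. \<forall>k. p k \<in> N k}"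
      by simp_all
  qed
  define P where "P = {p \<in> U. \<forall>k. p k \<in> (if k = 0 then {\<zero>} else J k)}"
  have "ideal P S"
    unfolding P_def
  proof (rule ideal_S)
    fix i m x y assume "x \<in> J i" "y \<in> (if m = 0 then {\<zero>} else J m)"
    then show "x \<otimes> y \<in> (if i + m = 0 then {\<zero>} else J (i + m))"
      using J_mult[of x i y m] by (auto split: if_splits)
  qed (simp add: zeroideal J_ideal)
  then obtain E where E: "E \<subseteq> carrier S" "finite E" "P = Idl\<^bsub>S\<^esub> E" using S.finetely_gen by blast
  have EP: "E \<subseteq> P" unfolding E(3) by (rule S.genideal_self[OF E(1)])
  have "\<forall>p\<in>E. \<exists>n. bound \<zero> n p" using EP U_up by (auto simp: P_def)
  then obtain f where f: "\<And>p. p \<in> E \<Longrightarrow> bound \<zero> (f p) p" by metis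
  define D where "D = (\<Sum>p\<in>E. f p)"
  have D: "p k = \<zero>" if "p \<in> E" "k > D" for p k
  proof -
    have "f p \<le> D" unfolding D_def by (rule member_le_sum) (use that E in auto)
    then show ?thesis using bound.bound[OF f[OF that(1)]] that(2) by simp
  qed
  have "P \<subseteq> {p \<in> U. \<forall>k. p k \<in> split D k}"
    unfolding E(3)
  proof (rule S.genideal_minimal)
    show "ideal {p \<in> U. \<forall>k. p k \<in> split D k} S" by (rule ideal_S) (rule split_ideal, rule split_mult)
    show "E \<subseteq> {p \<in> U. \<forall>k. p k \<in> split D k}"
    proof
      fix p assume p: "p \<in> E"
      then have "p \<in> P" using EP by blast
      then have pU: "p \<in> U" and "p 0 \<in> (if 0 = (0::nat) then {\<zero>} else J 0)"
        unfolding P_def by blast+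
      then have p0: "p 0 = \<zero>" by simp
      have "p k \<in> split D k" for k
      proof (cases "k = 0 \<or> k > D")
        case True
        then have "p k = \<zero>" using p0 D[OF p] by auto
        then show ?thesis using additive_subgroup.zero_closed[OF ideal.axioms(1)[OF split_ideal]] by simp
      next
        case False
        \<comment> \<open>The splitting is \<open>i = k\<close> with second factor
          \<open>\<one>\<close>, which uses \<open>1 \<le> k \<le> D\<close> and
          \<open>J 0 = carrier R\<close>.\<close>
        then have "p k \<otimes> \<one> \<in> split D k" using UJ[OF pU] J_0 by (intro split_intro[of k]) auto
        then show ?thesis using J_carrier[OF UJ[OF pU]] by simp
      qed
      then show "p \<in> {p \<in> U. \<forall>k. p k \<in> split D k}" using pU by simp
    qed
  qed
  then have coeff: "p k \<in> split D k" if "p \<in> P" for p k using that by blast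
  have "x \<in> split D k" if "k \<ge> 1" "x \<in> J k" for k x
  proof -
    \<comment> \<open>The monomial \<open>x t^k\<close>; as \<open>k \<ge> 1\<close>, it has no
      constant term and lies in \<open>P\<close>.\<close>
    have "(\<lambda>i. if i = k then x else \<zero>) \<in> up R"
      using that by (intro mem_upI exI[of _ k]) (auto simp: bound_def)
    then have "(\<lambda>i. if i = k then x else \<zero>) \<in> P" using that by (auto simp: P_def U_def)
    from coeff[OF this, of k] show ?thesis by simp
  qed
  then have "J k \<subseteq> split D k" if "k \<ge> 1" for k using that by blast
  then show ?thesis by (rule that)
qed

end

section \<open>Symbolic powers via multipliers outside the primes\<close>

context domain
begin

lemma symbolic_primes_prime:
  assumes "ideal I R" "P \<in> symbolic_primes R c I"
  shows "primeideal P R" "I \<subseteq> P"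
  using assms subset_of_Ass by (cases c; force simp: mem_Ass_iff Min_primes_def)+

text \<open>This covers \<open>k = 0\<close> too, where \<open>ideal_pow I 0\<close> is the whole
  ring and \<open>\<one>\<close> serves as multiplier, so multiplicativity and monotonicity need no
  case distinction.\<close>

lemma mem_symbolic_power_iff:
  assumes I: "ideal I R"
  shows "x \<in> symbolic_power R c I k \<longleftrightarrow>
    x \<in> carrier R \<and> (\<forall>P\<in>symbolic_primes R c I. \<exists>s\<in>carrier R - P. s \<otimes> x \<in> ideal_pow I k)"
proof (cases "k = 0")
  case True
  have "\<one> \<in> carrier R - P" if "P \<in> symbolic_primes R c I" for P
    using primeideal.I_notcarr ideal.one_imp_carrier primeideal.axioms(1)
      symbolic_primes_prime(1)[OF I that] by fastforce
  then show ?thesis using True by (auto simp: symbolic_power_def)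
next
  case False
  have "loc_contraction R P (ideal_pow I k) = {r \<in> carrier R. \<exists>s\<in>carrier R - P. s \<otimes> r \<in> ideal_pow I k}"
    if "P \<in> symbolic_primes R c I" for P
    using loc_contraction_eq symbolic_primes_prime(1)[OF I that] ideal_pow_ideal[OF I] .
  then show ?thesis using False by (auto simp: symbolic_power_def)
qed

lemma symbolic_power_mult:
  assumes I: "ideal I R" and x: "x \<in> symbolic_power R c I a" and y: "y \<in> symbolic_power R c I b"
  shows "x \<otimes> y \<in> symbolic_power R c I (a + b)"
  unfolding mem_symbolic_power_iff[OF I]
proof (intro conjI ballI)
  show "x \<otimes> y \<in> carrier R" using x y by (simp add: mem_symbolic_power_iff[OF I])
  fix P assume P: "P \<in> symbolic_primes R c I"
  obtain s t where *: "s \<in> carrier R - P" "t \<in> carrier R - P" "x \<in> carrier R" "y \<in> carrier R"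
    "s \<otimes> x \<in> ideal_pow I a" "t \<otimes> y \<in> ideal_pow I b"
    using x y P unfolding mem_symbolic_power_iff[OF I] by blast
  have "s \<otimes> t \<in> carrier R - P"
    using * primeideal.I_prime[OF symbolic_primes_prime(1)[OF I P], of s t] by auto
  moreover have "(s \<otimes> t) \<otimes> (x \<otimes> y) = (s \<otimes> x) \<otimes> (t \<otimes> y)" using * by (simp add: m_ac)
  ultimately show "\<exists>u\<in>carrier R - P. u \<otimes> (x \<otimes> y) \<in> ideal_pow I (a + b)"
    using ideal_pow_mult[OF I *(5,6)] by (intro bexI[of _ "s \<otimes> t"]) simp_all
qed

lemma ideal_pow_subset_symbolic_power:
  assumes I: "ideal I R"
  shows "ideal_pow I k \<subseteq> symbolic_power R c I k"
proof
  fix x assume x: "x \<in> ideal_pow I k"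
  then have xc: "x \<in> carrier R" using ideal.Icarr[OF ideal_pow_ideal[OF I]] by simp
  have "\<one> \<in> carrier R - P" if "P \<in> symbolic_primes R c I" for P
    using primeideal.I_notcarr ideal.one_imp_carrier primeideal.axioms(1)
      symbolic_primes_prime(1)[OF I that] by fastforce
  then show "x \<in> symbolic_power R c I k"
    using x xc unfolding mem_symbolic_power_iff[OF I] by (intro conjI ballI bexI[of _ \<one>]) simp_all
qed

end

context graded_noetherian_domain
begin

lemma graded_symbolic_power:
  assumes I: "graded_ideal R A I"
  shows "graded_ideal R A (symbolic_power R c I k)"
proof -
  have idI: "ideal I R" by (rule graded_idealD[OF I])
  define K where "K P = {r \<in> carrier R. \<exists>s\<in>carrier R - P. s \<otimes> r \<in> ideal_pow I k}" for P
  have gK: "graded_ideal R A (K P)" if "P \<in> symbolic_primes R c I" for P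
    unfolding K_def
    using symbolic_primes_prime(1)[OF idI that] graded_ideal_pow[OF I] by (rule graded_saturation)
  have mem: "x \<in> symbolic_power R c I k \<longleftrightarrow>
    x \<in> carrier R \<and> (\<forall>P\<in>symbolic_primes R c I. x \<in> K P)" for x
    by (auto simp: mem_symbolic_power_iff[OF idI] K_def)
  have id: "ideal (K P) R" if "P \<in> symbolic_primes R c I" for P by (rule graded_idealD[OF gK[OF that]])
  have "ideal (symbolic_power R c I k) R"
  proof (rule cring_ideal_by_closure)
    show "symbolic_power R c I k \<subseteq> carrier R" by (auto simp: mem)
    show "\<zero> \<in> symbolic_power R c I k"
      using additive_subgroup.zero_closed[OF ideal.axioms(1)[OF id]] by (simp add: mem)
    show "x \<oplus> y \<in> symbolic_power R c I k"
      if "x \<in> symbolic_power R c I k" "y \<in> symbolic_power R c I k" for x y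
      using that additive_subgroup.a_closed[OF ideal.axioms(1)[OF id]] by (simp add: mem)
    show "r \<otimes> x \<in> symbolic_power R c I k"
      if "r \<in> carrier R" "x \<in> symbolic_power R c I k" for r x
      using that ideal.I_l_closed[OF id] by (simp add: mem)
  qed
  then show ?thesis using graded_idealD(2)[OF gK] by (simp add: graded_ideal_iff mem)
qed

text \<open>Guards against the empty intersection, which would make every symbolic power the whole
  ring. A maximal colon ideal gives an associated prime, and the existence of a prime over
  \<open>I\<close> gives a minimal one.\<close>

lemma symbolic_primes_nonempty:
  assumes I: "graded_ideal R A I" and proper: "I \<noteq> carrier R"
  shows "symbolic_primes R c I \<noteq> {}"
proof -
  have idI: "ideal I R" by (rule graded_idealD[OF I])
  obtain g d where g: "g \<in> A d" "primeideal (colon R I g) R"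
    using homogeneous_associated_prime[OF I proper] .
  then have ass: "colon R I g \<in> Ass R I" unfolding mem_Ass_iff[OF idI] by (intro conjI bexI[of _ g]) simp_all
  then have "Min_primes R I \<noteq> {}" using minimal_prime_exists[OF g(2)] subset_of_Ass[OF idI] by simp
  then show ?thesis using ass by (cases c) auto
qed

lemma symbolic_power_filtration:
  assumes I: "graded_ideal R A I" and proper: "I \<noteq> carrier R" and nonzero: "I \<noteq> {\<zero>}"
  shows "graded_filtration R A (symbolic_power R c I)"
proof
  have idI: "ideal I R" by (rule graded_idealD[OF I])
  show "graded_ideal R A (symbolic_power R c I k)" for k by (rule graded_symbolic_power[OF I])
  show "symbolic_power R c I 0 = carrier R" by (simp add: symbolic_power_def)
  show "x \<otimes> y \<in> symbolic_power R c I (a + b)"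
    if "x \<in> symbolic_power R c I a" "y \<in> symbolic_power R c I b" for x y a b
    using symbolic_power_mult[OF idI that] .
  show "symbolic_power R c I (Suc k) \<subseteq> symbolic_power R c I k" for k
    using ideal_pow_Suc_subset[OF idI] unfolding subset_iff mem_symbolic_power_iff[OF idI] by blast
  obtain P where P: "P \<in> symbolic_primes R c I" using symbolic_primes_nonempty[OF I proper] by blast
  interpret P: primeideal P R by (rule symbolic_primes_prime(1)[OF idI P])
  show "symbolic_power R c I 1 \<noteq> carrier R"
  proof
    \<comment> \<open>A multiplier \<open>s\<close> outside \<open>P\<close> taking
      \<open>\<one>\<close> into \<open>I\<close> would itself lie in \<open>I\<close>, hence in
      \<open>P\<close>.\<close>
    assume "symbolic_power R c I 1 = carrier R"
    then obtain s where s: "s \<in> carrier R - P" "s \<otimes> \<one> \<in> ideal_pow I 1"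
      using P mem_symbolic_power_iff[OF idI, of \<one> c 1] by auto
    then have "s \<in> P" using symbolic_primes_prime(2)[OF idI P] ideal_pow_1[OF idI] by auto
    then show False using s by simp
  qed
  show "symbolic_power R c I 1 \<noteq> {\<zero>}"
    using ideal_pow_subset_symbolic_power[OF idI, of 1 c] nonzero
      additive_subgroup.zero_closed[OF ideal.axioms(1)[OF idI]]
    unfolding ideal_pow_1[OF idI] by blast
qed

end

section \<open>Bounds for the v-number\<close>

text \<open>The generators are chosen inside \<open>T\<close> itself, which need not be an ideal;
  the case of interest is the degree-zero part \<open>B k\<close>. An ideal maximal among those
  generated by finite subsets of \<open>T\<close> absorbs every \<open>t\<close>.\<close>

lemma (in noetherian_ring) finite_subset_generates:
  assumes "T \<subseteq> carrier R"
  obtains F where "finite F" "F \<subseteq> T" "T \<subseteq> Idl F"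
proof -
  let ?\<A> = "{Idl F | F. finite F \<and> F \<subseteq> T}"
  have "?\<A> \<noteq> {}" by blast
  then have "\<exists>M\<in>?\<A>. \<forall>K\<in>?\<A>. M \<subseteq> K \<longrightarrow> K = M"
  proof (rule maximal_ideal_of_family)
    fix K assume "K \<in> ?\<A>"
    then show "ideal K R" using assms genideal_ideal by blast
  qed
  then obtain F where F: "finite F" "F \<subseteq> T" "\<forall>K\<in>?\<A>. Idl F \<subseteq> K \<longrightarrow> K = Idl F" by blast
  have "t \<in> Idl F" if t: "t \<in> T" for t
  proof -
    have sub: "insert t F \<subseteq> carrier R" using t F(2) assms by blast
    have "Idl (insert t F) \<in> ?\<A>" using F t by blast
    moreover have "Idl F \<subseteq> Idl (insert t F)" using subset_Idl_subset[OF sub] by blast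
    ultimately have "Idl (insert t F) = Idl F" using F(3) by blast
    then show ?thesis using genideal_self[OF sub] by auto
  qed
  then show ?thesis using that F(1,2) by blast
qed

section \<open>Nakayama's lemma with explicit linear combinations\<close>

context cring
begin

text \<open>For an ideal \<open>Q\<close>, the product of \<open>Q\<close> with the ideal generated
  by \<open>ys\<close>. The recursion lets the induction for Nakayama's lemma remove one generator
  at a time.\<close>

primrec lincombs :: "'a set \<Rightarrow> 'a list \<Rightarrow> 'a set" where
  "lincombs Q [] = {\<zero>}"
| "lincombs Q (y # ys) = {q \<otimes> y \<oplus> z | q z. q \<in> Q \<and> z \<in> lincombs Q ys}"

lemma lincombs_ideal:
  assumes Q: "ideal Q R" and "set ys \<subseteq> carrier R"
  shows "ideal (lincombs Q ys) R"
  using assms(2)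
proof (induction ys)
  case Nil
  then show ?case by (simp add: zeroideal)
next
  case (Cons y ys)
  interpret Q: ideal Q R by (rule Q)
  interpret L: ideal "lincombs Q ys" R using Cons by simp
  have y: "y \<in> carrier R" using Cons by simp
  show ?case
  proof (rule cring_ideal_by_closure)
    show "lincombs Q (y # ys) \<subseteq> carrier R" using y Q.Icarr L.Icarr by auto
    have "\<zero> = \<zero> \<otimes> y \<oplus> \<zero>" using y by simp
    then show "\<zero> \<in> lincombs Q (y # ys)" unfolding lincombs.simps using Q.zero_closed L.zero_closed by blast
  next
    fix u v assume "u \<in> lincombs Q (y # ys)" "v \<in> lincombs Q (y # ys)"
    then obtain p z q w where *: "u = p \<otimes> y \<oplus> z" "v = q \<otimes> y \<oplus> w" "p \<in> Q" "q \<in> Q"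
      "z \<in> lincombs Q ys" "w \<in> lincombs Q ys" by auto
    then have "u \<oplus> v = (p \<oplus> q) \<otimes> y \<oplus> (z \<oplus> w)"
      using y Q.Icarr L.Icarr by (simp add: l_distr a_ac)
    then show "u \<oplus> v \<in> lincombs Q (y # ys)"
      unfolding lincombs.simps using Q.a_closed[OF *(3,4)] L.a_closed[OF *(5,6)] by blast
  next
    fix r u assume r: "r \<in> carrier R" and "u \<in> lincombs Q (y # ys)"
    then obtain p z where *: "u = p \<otimes> y \<oplus> z" "p \<in> Q" "z \<in> lincombs Q ys" by auto
    then have "r \<otimes> u = (r \<otimes> p) \<otimes> y \<oplus> r \<otimes> z"
      using r y Q.Icarr L.Icarr by (simp add: r_distr m_assoc)
    then show "r \<otimes> u \<in> lincombs Q (y # ys)"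
      unfolding lincombs.simps using Q.I_l_closed[OF *(2) r] L.I_l_closed[OF *(3) r] by blast
  qed
qed

lemma lincombs_intro:
  assumes Q: "ideal Q R" and "set ys \<subseteq> carrier R" "q \<in> Q" "y \<in> set ys"
  shows "q \<otimes> y \<in> lincombs Q ys"
  using assms(2,4)
proof (induction ys)
  case (Cons x xs)
  have q: "q \<in> carrier R" using Q assms(3) by (rule ideal.Icarr)
  have L: "ideal (lincombs Q xs) R" using lincombs_ideal[OF Q] Cons.prems by simp
  show ?case
  proof (cases "y = x")
    case True
    have "q \<otimes> y = q \<otimes> x \<oplus> \<zero>" using True q Cons.prems by simp
    moreover have "\<zero> \<in> lincombs Q xs" by (rule additive_subgroup.zero_closed[OF ideal.axioms(1)[OF L]])
    ultimately show ?thesis unfolding lincombs.simps using assms(3) by blast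
  next
    case False
    then have y: "q \<otimes> y \<in> lincombs Q xs" using Cons by simp
    then have "q \<otimes> y \<in> carrier R" by (rule ideal.Icarr[OF L])
    then have "q \<otimes> y = \<zero> \<otimes> x \<oplus> q \<otimes> y" using Cons.prems by simp
    then show ?thesis
      unfolding lincombs.simps using y additive_subgroup.zero_closed[OF ideal.axioms(1)[OF Q]] by blast
  qed
qed simp

end

text \<open>The factor \<open>\<one> \<ominus> q\<close> makes the induction on the generators work; \<open>q = \<zero>\<close> is the
  usual statement.\<close>

lemma (in domain) Nakayama:
  assumes Q: "ideal Q R" "\<one> \<notin> Q"
    and "set ys \<subseteq> carrier R" "q \<in> Q"
    and "\<And>y. y \<in> set ys \<Longrightarrow> (\<one> \<ominus> q) \<otimes> y \<in> lincombs Q ys"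
  shows "set ys \<subseteq> {\<zero>}"
  using assms(3-)
proof (induction ys arbitrary: q)
  case (Cons y ys)
  interpret Q: ideal Q R by (rule Q)
  have L: "ideal (lincombs Q ys) R" using lincombs_ideal[OF Q(1)] Cons.prems by simp
  interpret L: ideal "lincombs Q ys" R by (rule L)
  have y: "y \<in> carrier R" and ys: "set ys \<subseteq> carrier R" and q: "q \<in> carrier R"
    using Cons.prems Q.Icarr by auto
  obtain p z where p: "p \<in> Q" and z: "z \<in> lincombs Q ys" and eq: "(\<one> \<ominus> q) \<otimes> y = p \<otimes> y \<oplus> z"
    using Cons.prems(3)[of y] by auto
  have pc: "p \<in> carrier R" and zc: "z \<in> carrier R" using p z Q.Icarr L.Icarr by auto
  \<comment> \<open>Moving the \<open>y\<close> terms of \<open>eq\<close> to one side gives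
    \<open>c \<otimes> y = z\<close>, a combination of \<open>ys\<close> alone.\<close>
  define c where "c = \<one> \<ominus> (q \<oplus> p)"
  have c: "c \<in> carrier R" using q pc by (simp add: c_def)
  have cy: "c \<otimes> y = z"
  proof -
    have "c \<otimes> y = (\<one> \<ominus> q) \<otimes> y \<ominus> p \<otimes> y"
      using q pc y by (simp add: c_def a_minus_def l_distr l_minus minus_add a_assoc)
    also have "\<dots> = z" unfolding eq using pc y zc by algebra
    finally show ?thesis .
  qed
  \<comment> \<open>Chosen so that
    \<open>\<one> \<ominus> t = (\<one> \<ominus> q) \<otimes> c\<close> with
    \<open>t \<in> Q\<close>, the form the induction hypothesis asks for.\<close>
  define t where "t = (q \<oplus> (q \<oplus> p)) \<ominus> q \<otimes> (q \<oplus> p)"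
  have t: "t \<in> Q"
    using Cons.prems(2) p q pc by (simp add: t_def a_minus_def Q.I_l_closed)
  have tc: "\<one> \<ominus> t = (\<one> \<ominus> q) \<otimes> c"
    using q pc unfolding t_def c_def by algebra
  have "set ys \<subseteq> {\<zero>}"
  proof (rule Cons.IH[OF ys t])
    fix x assume x: "x \<in> set ys"
    then have xc: "x \<in> carrier R" using ys by blast
    obtain p' z' where *: "p' \<in> Q" "z' \<in> lincombs Q ys" "(\<one> \<ominus> q) \<otimes> x = p' \<otimes> y \<oplus> z'"
      using Cons.prems(3)[of x] x by auto
    have pz: "p' \<in> carrier R" "z' \<in> carrier R" using * Q.Icarr L.Icarr by auto
    \<comment> \<open>The factor \<open>c\<close> turns the unwanted term
      \<open>p' \<otimes> y\<close> into \<open>p' \<otimes> z\<close>.\<close>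
    have "(\<one> \<ominus> t) \<otimes> x = c \<otimes> ((\<one> \<ominus> q) \<otimes> x)" unfolding tc using q c xc by (simp add: m_ac)
    also have "\<dots> = p' \<otimes> z \<oplus> c \<otimes> z'"
      unfolding *(3) cy[symmetric] using c y pz by (simp add: r_distr m_ac)
    also have "\<dots> \<in> lincombs Q ys" using z *(2) c pz by (simp add: L.I_l_closed)
    finally show "(\<one> \<ominus> t) \<otimes> x \<in> lincombs Q ys" .
  qed
  then have "lincombs Q ys \<subseteq> {\<zero>}"
  proof (induction ys)
    case (Cons x xs)
    then show ?case using Q.Icarr by auto
  qed simp
  then have "c \<otimes> y = \<zero>" using z cy by auto
  \<comment> \<open>\<open>c\<close> is congruent to \<open>\<one>\<close> modulo the proper ideal
    \<open>Q\<close>, hence nonzero; in a domain this is enough to cancel it.\<close>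
  moreover have "c \<noteq> \<zero>"
  proof
    assume "c = \<zero>"
    then have "\<one> = q \<oplus> p" using q pc by (simp add: c_def)
    then show False using Q(2) Q.a_closed[OF Cons.prems(2) p] by simp
  qed
  ultimately have "y = \<zero>" using c y integral by blast
  then show ?case using \<open>set ys \<subseteq> {\<zero>}\<close> by simp
qed simp

lemma (in domain) nat_pow_nonzero:
  "x \<in> carrier R \<Longrightarrow> x \<noteq> \<zero> \<Longrightarrow> x [^] (n::nat) \<noteq> \<zero>"
  by (induction n) (auto simp: integral_iff)

section \<open>The v-number and the initial degree along a filtration\<close>

context graded_filtration
begin

abbreviation ideg :: "nat \<Rightarrow> nat" where
  "ideg k \<equiv> initial_degree R A (J k)"

abbreviation vnum :: "nat \<Rightarrow> nat" where
  "vnum k \<equiv> v_number R A (J k)"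

lemma J_pow: "x \<in> J m \<Longrightarrow> x [^] (n::nat) \<in> J (n * m)"
proof (induction n)
  case (Suc n)
  then show ?case using J_mult[of "x [^] n" "n * m" x m] by (simp add: add.commute)
qed (simp add: J_0)

lemma J_proper: "k \<ge> 1 \<Longrightarrow> J k \<noteq> carrier R"
  using J_antimono[of 1 k] J_1_proper J_carrier by blast

lemma obtain_homogeneous:
  obtains g e where "g \<in> J 1" "g \<in> A e" "g \<noteq> \<zero>"
proof -
  obtain x where x: "x \<in> J 1" "x \<noteq> \<zero>" using J_1_nonzero J_zero by blast
  then have "supp x \<noteq> {}" using supp_empty_iff by auto
  then obtain e where "hcomp e x \<noteq> \<zero>" by (auto simp: supp_def)
  then show ?thesis using that[of "hcomp e x" e] x J_hcomp hcomp_A by simp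
qed

lemma ideg_le: "x \<in> J k \<Longrightarrow> x \<in> A d \<Longrightarrow> x \<noteq> \<zero> \<Longrightarrow> ideg k \<le> d"
  unfolding initial_degree_def by (rule Least_le) blast

lemma ideg_attained:
  obtains x where "x \<in> J k" "x \<in> A (ideg k)" "x \<noteq> \<zero>"
proof -
  obtain g e where g: "g \<in> J 1" "g \<in> A e" "g \<noteq> \<zero>" by (rule obtain_homogeneous)
  \<comment> \<open>The powers of \<open>g\<close> show that the \<open>LEAST\<close> in
    \<open>initial_degree\<close> ranges over a nonempty set.\<close>
  then have "g [^] k \<in> J k \<inter> A (k * e)" "g [^] k \<noteq> \<zero>"
    using J_pow[OF g(1), of k] A_pow[OF g(2)] nat_pow_nonzero by simp_all
  then have "J k \<inter> A (k * e) \<noteq> {\<zero>}" by blast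
  then have "J k \<inter> A (ideg k) \<noteq> {\<zero>}" unfolding initial_degree_def by (rule LeastI)
  then show ?thesis using that J_zero A_zero by blast
qed

text \<open>A proper graded ideal has a prime colon ideal by a homogeneous element, so the
  \<open>LEAST\<close> in \<open>v_number\<close> is attained.\<close>

lemma v_number_attained:
  assumes "k \<ge> 1"
  obtains f where "f \<in> A (vnum k)" "primeideal (colon R (J k) f) R"
proof -
  obtain g d where g: "g \<in> A d" "primeideal (colon R (J k) g) R"
    using homogeneous_associated_prime[OF graded_J J_proper[OF assms]] .
  then have "colon R (J k) g \<in> Ass R (J k)"
    unfolding mem_Ass_iff[OF J_ideal] by (intro conjI bexI[of _ g]) simp_all
  then have "\<exists>f\<in>A d. \<exists>P\<in>Ass R (J k). colon R (J k) f = P" using g(1) by blast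
  then have "\<exists>f\<in>A (vnum k). \<exists>P\<in>Ass R (J k). colon R (J k) f = P"
    unfolding v_number_def by (rule LeastI)
  then obtain f where f: "f \<in> A (vnum k)" "colon R (J k) f \<in> Ass R (J k)" by auto
  then have "primeideal (colon R (J k) f) R" using mem_Ass_iff[OF J_ideal] by metis
  with f(1) show ?thesis by (rule that)
qed

lemma v_number_le:
  assumes "f \<in> A d" "primeideal (colon R (J k) f) R"
  shows "vnum k \<le> d"
proof -
  have "colon R (J k) f \<in> Ass R (J k)"
    unfolding mem_Ass_iff[OF J_ideal] using assms by (intro conjI bexI[of _ f]) simp_all
  then show ?thesis unfolding v_number_def using assms(1) by (intro Least_le) blast
qed

lemma ideg_le_v_number: "\<exists>e. \<forall>k\<ge>1. ideg k \<le> vnum k + e"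
proof -
  obtain g e where g: "g \<in> J 1" "g \<in> A e" "g \<noteq> \<zero>" by (rule obtain_homogeneous)
  \<comment> \<open>The same \<open>e\<close> serves every \<open>k\<close>: by primality
    \<open>g\<close> itself, and not merely \<open>g [^] k\<close>, lies in the colon ideal.\<close>
  have "ideg k \<le> vnum k + e" if "k \<ge> 1" for k
  proof -
    obtain f where f: "f \<in> A (vnum k)" "primeideal (colon R (J k) f) R"
      using v_number_attained[OF \<open>k \<ge> 1\<close>] .
    have fc: "f \<in> carrier R" and gc: "g \<in> carrier R"
      using A_carrier[OF f(1)] A_carrier[OF g(2)] by simp_all
    have "f \<noteq> \<zero>"
    proof
      assume "f = \<zero>"
      then have "\<one> \<in> colon R (J k) f" by (simp add: colon_def)
      then have "colon R (J k) f = carrier R" 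
        by (rule ideal.one_imp_carrier[OF primeideal.axioms(1)[OF f(2)]])
      then show False using primeideal.I_notcarr[OF f(2)] by simp
    qed
    have "g [^] k \<in> J k" using J_pow[OF g(1), of k] by simp
    then have "g [^] k \<in> colon R (J k) f"
      using fc gc ideal.I_r_closed[OF J_ideal] by (simp add: colon_def)
    then have "g \<in> colon R (J k) f" by (rule prime_power_mem[OF f(2) gc])
    then have "g \<otimes> f \<in> J k" by (simp add: colon_def)
    moreover have "g \<otimes> f \<in> A (vnum k + e)" using A_mult[OF g(2) f(1)] by (simp add: add.commute)
    moreover have "g \<otimes> f \<noteq> \<zero>" using \<open>f \<noteq> \<zero>\<close> g(3) fc gc by (simp add: integral_iff)
    ultimately show ?thesis by (rule ideg_le)
  qed
  then show ?thesis by blast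
qed

text \<open>The colon ideals \<open>J (\<kappa> n + s) : w n\<close> increase with \<open>n\<close>, so a single homogeneous multiplier
  makes all of them prime from some point on; its degree bounds the error term.\<close>

lemma v_number_eventually_le_chain:
  fixes w :: "nat \<Rightarrow> 'a" and \<kappa> \<epsilon> :: "nat \<Rightarrow> nat"
  assumes w: "\<And>n. w n \<in> A (\<epsilon> n)" "\<And>n. w n \<notin> J (\<kappa> n + 1)"
    and step: "\<And>n. \<exists>i y. 1 \<le> i \<and> i \<le> D \<and> \<kappa> (Suc n) = \<kappa> n + i \<and> y \<in> J i \<and> w (Suc n) = y \<otimes> w n"
  shows "\<exists>C N. \<forall>k\<ge>N. \<exists>n. \<kappa> n \<le> k \<and> vnum k \<le> \<epsilon> n + C"
proof -
  have wc: "w n \<in> carrier R" for n using A_carrier[OF w(1)] .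
  have "\<exists>N C. \<forall>n\<ge>N. vnum (\<kappa> n + s) \<le> \<epsilon> n + C" if s: "s \<ge> 1" for s
  proof -
    define L where "L n = colon R (J (\<kappa> n + s)) (w n)" for n
    have gL: "graded_ideal R A (L n)" for n unfolding L_def by (rule graded_colon[OF graded_J w(1)])
    have "L n \<subseteq> L (Suc n)" for n
    proof
      fix r assume "r \<in> L n"
      then have r: "r \<in> carrier R" "r \<otimes> w n \<in> J (\<kappa> n + s)" by (simp_all add: L_def colon_def)
      obtain i y where y: "\<kappa> (Suc n) = \<kappa> n + i" "y \<in> J i" "w (Suc n) = y \<otimes> w n" using step by blast
      have "r \<otimes> w (Suc n) = y \<otimes> (r \<otimes> w n)" using r wc y by (simp add: m_ac)
      also have "\<dots> \<in> J (\<kappa> (Suc n) + s)" using J_mult[OF y(2) r(2)] y(1) by (simp add: ac_simps)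
      finally show "r \<in> L (Suc n)" using r by (simp add: L_def colon_def)
    qed
    then obtain N where N: "\<And>n. n \<ge> N \<Longrightarrow> L n = L N"
      using ascending_chain_stabilises[of L] graded_idealD(1)[OF gL] by blast
    \<comment> \<open>Otherwise \<open>w N\<close> would lie in \<open>J (\<kappa> N + s)\<close>,
      which is inside \<open>J (\<kappa> N + 1)\<close> because \<open>s \<ge> 1\<close>.\<close>
    have "\<one> \<notin> L N"
      using w(2)[of N] J_antimono[of "\<kappa> N + 1" "\<kappa> N + s"] s wc by (auto simp: L_def colon_def)
    then have "L N \<noteq> carrier R" by auto
    then obtain g e where g: "g \<in> A e" "primeideal (colon R (L N) g) R"
      using homogeneous_associated_prime[OF gL] by blast
    have "vnum (\<kappa> n + s) \<le> \<epsilon> n + e" if n: "n \<ge> N" for n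
    proof (rule v_number_le)
      show "g \<otimes> w n \<in> A (\<epsilon> n + e)" using A_mult[OF g(1) w(1)] by (simp add: add.commute)
      have "colon R (J (\<kappa> n + s)) (g \<otimes> w n) = colon R (L n) g"
        using wc[of n] A_carrier[OF g(1)] by (auto simp: L_def colon_def m_assoc)
      then show "primeideal (colon R (J (\<kappa> n + s)) (g \<otimes> w n)) R" using g(2) N[OF n] by simp
    qed
    then show ?thesis by blast
  qed
  then obtain N C where NC: "\<And>s n. s \<ge> 1 \<Longrightarrow> n \<ge> N s \<Longrightarrow> vnum (\<kappa> n + s) \<le> \<epsilon> n + C s" by metis
  \<comment> \<open>Consecutive values of \<open>\<kappa>\<close> differ by at most
    \<open>D\<close>, so only offsets \<open>s\<close> from 1 to \<open>D\<close> occur, and the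
    finitely many thresholds and constants can be replaced by their sums.\<close>
  define N' C' where "N' = (\<Sum>s\<in>{1..D}. N s)" and "C' = (\<Sum>s\<in>{1..D}. C s)"
  have NC': "N s \<le> N'" "C s \<le> C'" if "s \<in> {1..D}" for s
    unfolding N'_def C'_def using that by (auto intro: member_le_sum)
  have lt: "\<kappa> n < \<kappa> (Suc n)" "\<kappa> (Suc n) \<le> \<kappa> n + D" for n using step[of n] by auto
  have mono: "strict_mono \<kappa>" using lt(1) by (rule strict_mono_Suc_iff[THEN iffD2, rule_format])
  have "\<exists>n. \<kappa> n \<le> k \<and> vnum k \<le> \<epsilon> n + C'" if k: "k \<ge> Suc (\<kappa> N')" for k
  proof -
    \<comment> \<open>With \<open>q = n + 1\<close>, minimality gives \<open>\<kappa> n < k\<close>,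
      so the offset of \<open>k\<close> from \<open>\<kappa> n\<close> is at least 1, as the bound
      above requires. The lower bound on \<open>k\<close> ensures \<open>n \<ge> N'\<close>.\<close>
    define q where "q = (LEAST q. k \<le> \<kappa> q)"
    have q: "k \<le> \<kappa> q" unfolding q_def using strict_mono_imp_increasing[OF mono] by (rule LeastI)
    have "q > N'"
    proof (rule ccontr)
      assume "\<not> q > N'"
      then have "\<kappa> q \<le> \<kappa> N'" using strict_mono_less_eq[OF mono] by simp
      then show False using q k by simp
    qed
    then obtain n where n: "q = Suc n" "n \<ge> N'" by (cases q) auto
    have "\<kappa> n < k" using not_less_Least[of n "\<lambda>q. k \<le> \<kappa> q"] n(1) unfolding q_def by simp
    moreover define s where "s = k - \<kappa> n"
    ultimately have s: "s \<in> {1..D}" "k = \<kappa> n + s" using q lt(2)[of n] unfolding n(1) by auto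
    have "vnum k \<le> \<epsilon> n + C s" unfolding s(2) using s(1) n(2) NC'(1)[OF s(1)] by (intro NC) auto
    then show ?thesis using NC'(2)[OF s(1)] s(2) by (intro exI[of _ n]) auto
  qed
  then show ?thesis by blast
qed

end

section \<open>Asymptotics\<close>

locale noetherian_filtration = graded_filtration R A J for R (structure) and A and J +
  fixes D :: nat
  assumes J_split: "k \<ge> 1 \<Longrightarrow> J k \<subseteq> split D k"
begin

lemma D_pos: "D \<ge> 1"
proof (rule ccontr)
  assume "\<not> D \<ge> 1"
  \<comment> \<open>For \<open>D = 0\<close> there are no generators, so \<open>split D 1\<close>
    vanishes while \<open>J 1\<close> does not.\<close>
  then have "split D 1 \<subseteq> {\<zero>}" by (intro split_minimal zeroideal) auto
  then show False using J_split[of 1] J_1_nonzero J_zero[of 1] by blast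
qed

text \<open>The least slope \<open>ideg i / i\<close> for \<open>1 \<le> i \<le> D\<close>; it turns
  out to be the Waldschmidt constant. Denominators are cleared so that the later estimates stay in
  the natural numbers.\<close>

lemma slope_minimum:
  obtains m where "1 \<le> m" "m \<le> D" "\<forall>i. 1 \<le> i \<longrightarrow> i \<le> D \<longrightarrow> ideg m * i \<le> m * ideg i"
proof -
  define q where "q i = real (ideg i) / real i" for i
  have "q ` {1..D} \<noteq> {}" "finite (q ` {1..D})" using D_pos by auto
  then have "Min (q ` {1..D}) \<in> q ` {1..D}" by (intro Min_in)
  then obtain m where m: "m \<in> {1..D}" "q m = Min (q ` {1..D})" by auto
  have "ideg m * i \<le> m * ideg i" if i: "1 \<le> i" "i \<le> D" for i
  proof -
    have "q m \<le> q i" unfolding m(2) using i by (intro Min_le) auto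
    then have "real (ideg m) * real i \<le> real (ideg i) * real m"
      using i m(1) by (simp add: q_def frac_le_eq divide_simps)
    then have "real (ideg m * i) \<le> real (m * ideg i)" by (simp add: mult.commute)
    then show ?thesis by (simp only: of_nat_le_iff)
  qed
  then show ?thesis using that[of m] m(1) by simp
qed

text \<open>The elements living in degrees on or above the line of slope \<open>a / m\<close>, with
  the denominator cleared.\<close>

definition high :: "nat \<Rightarrow> nat \<Rightarrow> nat \<Rightarrow> 'a set" where
  "high m a k = {x \<in> carrier R. \<forall>d. m * d < a * k \<longrightarrow> hcomp d x = \<zero>}"

lemma high_mult:
  assumes x: "x \<in> high m a i" and y: "y \<in> high m a j"
  shows "x \<otimes> y \<in> high m a (i + j)"
proof -
  have c: "x \<in> carrier R" "y \<in> carrier R" using x y by (simp_all add: high_def)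
  have "hcomp d (x \<otimes> y) = \<zero>" if d: "m * d < a * (i + j)" for d
  proof -
    have "hcomp p x \<otimes> hcomp (d - p) y \<in> {\<zero>}" if "p \<in> {..d}" for p
    proof -
      \<comment> \<open>If both degrees reached their bounds, so would their sum \<open>d\<close>;
        hence one of the two components is zero.\<close>
      have "m * p + m * (d - p) = m * d" using that by (simp flip: add_mult_distrib2)
      then have "m * p < a * i \<or> m * (d - p) < a * j" using d by (auto simp: add_mult_distrib2)
      then have "hcomp p x = \<zero> \<or> hcomp (d - p) y = \<zero>" using x y by (auto simp: high_def)
      then show ?thesis using c by auto
    qed
    then have "(\<Oplus>p\<in>{..d}. hcomp p x \<otimes> hcomp (d - p) y) \<in> {\<zero>}"
      by (rule ideal.finsum_mem[OF zeroideal])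
    then show ?thesis using hcomp_mult[OF c] by simp
  qed
  then show ?thesis using c by (simp add: high_def)
qed

lemma high_ideal: "ideal (high m a k) R"
proof (rule cring_ideal_by_closure)
  fix r x assume "r \<in> carrier R" "x \<in> high m a k"
  then show "r \<otimes> x \<in> high m a k" using high_mult[of r m a 0 x k] by (simp add: high_def)
qed (auto simp: high_def hcomp_add)

text \<open>The bound for indices up to \<open>D\<close> spreads to all \<open>k\<close>: elements
  of \<open>J k\<close> are built from products whose second factor has smaller index, and degree
  bounds add under products.\<close>

lemma J_subset_high:
  assumes a: "\<And>i. 1 \<le> i \<Longrightarrow> i \<le> D \<Longrightarrow> a * i \<le> m * ideg i"
  shows "J k \<subseteq> high m a k"
proof (induction k rule: less_induct)
  case (less k)
  show ?case
  proof (cases "k = 0")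
    case True
    then show ?thesis by (auto simp: high_def)
  next
    case False
    have low: "J i \<subseteq> high m a i" if i: "1 \<le> i" "i \<le> D" for i
    proof
      fix x assume x: "x \<in> J i"
      have "hcomp d x = \<zero>" if d: "m * d < a * i" for d
      proof (rule ccontr)
        assume "hcomp d x \<noteq> \<zero>"
        then have "ideg i \<le> d" using ideg_le[of "hcomp d x" i d] J_hcomp[OF x] hcomp_A J_carrier[OF x] by simp
        then have "m * ideg i \<le> m * d" by (rule mult_le_mono2)
        then show False using a[OF i] d by linarith
      qed
      then show "x \<in> high m a i" using J_carrier[OF x] by (simp add: high_def)
    qed
    have "split D k \<subseteq> high m a k"
    proof (rule split_minimal[OF high_ideal])
      fix x y i assume *: "1 \<le> i" "i \<le> D" "i \<le> k" "x \<in> J i" "y \<in> J (k - i)"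
      have "y \<in> high m a (k - i)" using less.IH[of "k - i"] * by auto
      moreover have "x \<in> high m a i" using low * by auto
      ultimately show "x \<otimes> y \<in> high m a k" using high_mult[of x m a i y "k - i"] * by simp
    qed
    then show ?thesis using J_split[of k] False by simp
  qed
qed

text \<open>When the Waldschmidt constant is zero, degrees cannot show that powers of \<open>u\<close> stay out of
  the deeper terms of the filtration; fertility is the invariant that keeps a product extendable.\<close>

definition B :: "nat \<Rightarrow> 'a set" where
  "B k = J k \<inter> A 0"

text \<open>For \<open>w\<close> in \<open>J k\<close>, the class of \<open>w\<close> in degree
  \<open>k\<close> of the associated graded ring of the filtration has nonzero products with classes
  of elements of \<open>B j\<close> for infinitely many \<open>j\<close>. Infinitely many, rather
  than one, so that the property survives a split into finitely many cases.\<close>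

definition fertile :: "'a \<Rightarrow> nat \<Rightarrow> bool" where
  "fertile w k \<longleftrightarrow> infinite {j. \<exists>x\<in>B j. w \<otimes> x \<notin> J (k + j + 1)}"

lemma B_carrier: "B k \<subseteq> carrier R"
  by (auto simp: B_def)

lemma hcomp_0_B: "x \<in> J k \<Longrightarrow> hcomp 0 x \<in> B k"
  using J_hcomp hcomp_A by (simp add: B_def)

lemma hcomp_0_preimage_ideal:
  assumes "ideal K R"
  shows "ideal {x \<in> carrier R. hcomp 0 x \<in> K} R"
proof -
  interpret K: ideal K R by fact
  show ?thesis
  proof (rule cring_ideal_by_closure)
    fix r x assume "r \<in> carrier R" "x \<in> {x \<in> carrier R. hcomp 0 x \<in> K}"
    then show "r \<otimes> x \<in> {x \<in> carrier R. hcomp 0 x \<in> K}"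
      by (simp add: hcomp_zero_mult K.I_l_closed)
  qed (auto simp: hcomp_add)
qed

text \<open>Projection to degree zero is multiplicative, so \<open>J_split\<close> descends to the
  degree-zero parts: components of positive degree contribute nothing.\<close>

lemma B_subset_by_split:
  assumes K: "ideal K R" and k: "k \<ge> 1"
    and mem: "\<And>i x y. 1 \<le> i \<Longrightarrow> i \<le> D \<Longrightarrow> i \<le> k \<Longrightarrow> x \<in> B i \<Longrightarrow> y \<in> B (k - i) \<Longrightarrow> x \<otimes> y \<in> K"
  shows "B k \<subseteq> K"
proof -
  have "split D k \<subseteq> {x \<in> carrier R. hcomp 0 x \<in> K}"
  proof (rule split_minimal[OF hcomp_0_preimage_ideal[OF K]])
    fix x y i assume *: "1 \<le> i" "i \<le> D" "i \<le> k" "x \<in> J i" "y \<in> J (k - i)"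
    have c: "x \<in> carrier R" "y \<in> carrier R" using J_carrier *(4,5) by auto
    have "hcomp 0 x \<otimes> hcomp 0 y \<in> K" using mem[OF *(1-3)] hcomp_0_B *(4,5) by simp
    then show "x \<otimes> y \<in> {x \<in> carrier R. hcomp 0 x \<in> K}" using c by (simp add: hcomp_zero_mult)
  qed
  moreover have "x \<in> J k" "hcomp 0 x = x" if "x \<in> B k" for x
    using that hcomp_self by (auto simp: B_def)
  ultimately show ?thesis using J_split[OF k] by fastforce
qed

text \<open>If \<open>\<one>\<close> were sterile, \<open>B j\<close> would lie in
  \<open>J (j + 1)\<close> for all large \<open>j\<close>, making \<open>B\<close> constant from
  some \<open>n\<close> on. Splitting then puts \<open>B n\<close> inside \<open>J 1\<close> times
  the ideal it generates, and Nakayama's lemma makes \<open>B n\<close> vanish, against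
  \<open>u [^] n\<close>.\<close>

lemma fertile_one:
  assumes u: "u \<in> J m" "u \<in> A 0" "u \<noteq> \<zero>" "m \<ge> 1"
  shows "fertile \<one> 0"
proof (rule ccontr)
  assume "\<not> fertile \<one> 0"
  then have "finite {j. \<exists>x\<in>B j. \<one> \<otimes> x \<notin> J (0 + j + 1)}" by (simp add: fertile_def)
  then obtain n where n: "\<forall>j\<in>{j. \<exists>x\<in>B j. \<one> \<otimes> x \<notin> J (0 + j + 1)}. j < n"
    unfolding finite_nat_set_iff_bounded by blast
  have step: "B j \<subseteq> B (Suc j)" if "j \<ge> n" for j
  proof
    fix x assume x: "x \<in> B j"
    then have "x \<in> carrier R" using B_carrier by blast
    then have "x \<in> J (Suc j)" using n x that by force
    then show "x \<in> B (Suc j)" using x by (simp add: B_def)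
  qed
  have B_le: "B n \<subseteq> B j" if "j \<ge> n" for j
    using that
  proof (induction j rule: dec_induct)
    case (step j)
    then show ?case using \<open>\<And>j. j \<ge> n \<Longrightarrow> B j \<subseteq> B (Suc j)\<close> by blast
  qed simp
  have B_ge: "B j \<subseteq> B n" if "j \<ge> n" for j using J_antimono[OF that] by (auto simp: B_def)
  obtain F where F: "finite F" "F \<subseteq> B n" "B n \<subseteq> Idl F"
    using finite_subset_generates[OF B_carrier] .
  obtain ys where ys: "set ys = F" using finite_list[OF F(1)] by blast
  have Fc: "F \<subseteq> carrier R" using F(2) B_carrier by blast
  let ?L = "lincombs (J 1) ys"
  have L: "ideal ?L R" using lincombs_ideal[OF J_ideal] Fc ys by simp
  \<comment> \<open>Splitting off a factor of index at most \<open>D\<close> leaves an index still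
    above \<open>n\<close>, where \<open>B\<close> is constant.\<close>
  let ?k = "n + D + 1"
  have "B ?k \<subseteq> ?L"
  proof (rule B_subset_by_split[OF L])
    fix i x y assume *: "1 \<le> i" "i \<le> D" "i \<le> ?k" "x \<in> B i" "y \<in> B (?k - i)"
    have x: "x \<in> J 1" "x \<in> carrier R" using *(1,4) J_antimono[of 1 i] by (auto simp: B_def)
    have "n \<le> ?k - i" using *(2) by simp
    then have y: "y \<in> Idl F" using B_ge *(5) F(3) by blast
    have "Idl F \<subseteq> colon R ?L x"
    proof (rule genideal_minimal)
      show "ideal (colon R ?L x) R" by (rule colon_ideal[OF L x(2)])
      show "F \<subseteq> colon R ?L x"
      proof
        fix f assume f: "f \<in> F"
        then have "x \<otimes> f \<in> ?L" using lincombs_intro[OF J_ideal, of ys x 1 f] Fc ys x(1) by simp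
        then show "f \<in> colon R ?L x" using f Fc x(2) by (auto simp: colon_def m_comm)
      qed
    qed
    then have "y \<in> carrier R" "y \<otimes> x \<in> ?L" using y by (auto simp: colon_def)
    then show "x \<otimes> y \<in> ?L" using x(2) by (simp add: m_comm)
  qed simp
  then have BL: "B n \<subseteq> ?L" using B_le[of ?k] by simp
  have "set ys \<subseteq> {\<zero>}"
  proof (rule Nakayama[of "J 1" ys \<zero>])
    show "\<one> \<notin> J 1" using ideal.one_imp_carrier[OF J_ideal] J_1_proper by blast
    fix y assume "y \<in> set ys"
    then have "y \<in> ?L" "y \<in> carrier R" using BL F(2) Fc ys by auto
    then show "(\<one> \<ominus> \<zero>) \<otimes> y \<in> ?L" by (simp add: a_minus_def)
  qed (use J_ideal Fc ys in simp_all)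
  then have "Idl F \<subseteq> {\<zero>}" using ys by (intro genideal_minimal zeroideal) simp
  moreover have "u [^] n \<in> B n"
  proof -
    have "u [^] n \<in> J (n * m)" by (rule J_pow[OF u(1)])
    moreover have "u [^] n \<in> A 0" using A_pow[OF u(2), of n] by simp
    ultimately show ?thesis using J_antimono[of n "n * m"] u(4) by (auto simp: B_def)
  qed
  moreover have "u [^] n \<noteq> \<zero>" using nat_pow_nonzero u A_carrier by blast
  ultimately show False using F(3) by blast
qed

text \<open>Suppose every product with an element of \<open>B 1\<close>, ..., \<open>B D\<close>
  were sterile. For finitely many generators this leaves only finitely many exceptional indices;
  beyond them every element of \<open>B j\<close> is reached through generators and carries
  \<open>w\<close> into \<open>J (k + j + 1)\<close>, so \<open>w\<close> would be sterile
  too.\<close>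

lemma fertile_step:
  assumes w: "w \<in> carrier R" and fert: "fertile w k"
  shows "\<exists>i y. 1 \<le> i \<and> i \<le> D \<and> y \<in> B i \<and> fertile (y \<otimes> w) (k + i)"
proof (rule ccontr)
  assume "\<not> ?thesis"
  then have sterile: "\<not> fertile (y \<otimes> w) (k + i)" if "1 \<le> i" "i \<le> D" "y \<in> B i" for i y
    using that by blast
  have "\<exists>F. finite F \<and> F \<subseteq> B i \<and> B i \<subseteq> Idl F" for i
    by (rule finite_subset_generates[OF B_carrier, of i]) (intro exI conjI)
  then obtain F where F: "\<And>i. finite (F i)" "\<And>i. F i \<subseteq> B i" "\<And>i. B i \<subseteq> Idl (F i)" by metis
  define bad where "bad i y = {j. \<exists>x\<in>B j. (y \<otimes> w) \<otimes> x \<notin> J (k + i + j + 1)}" for i y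
  have "finite (\<Union>i\<in>{1..D}. \<Union>y\<in>F i. bad i y)"
  proof (intro finite_UN_I F(1))
    fix i y assume "i \<in> {1..D}" "y \<in> F i"
    then have "\<not> fertile (y \<otimes> w) (k + i)" using sterile[of i y] F(2) by auto
    then show "finite (bad i y)" by (simp add: bad_def fertile_def)
  qed simp
  then obtain n where n: "\<And>i y j. i \<in> {1..D} \<Longrightarrow> y \<in> F i \<Longrightarrow> j \<in> bad i y \<Longrightarrow> j < n"
    unfolding finite_nat_set_iff_bounded by blast
  \<comment> \<open>With \<open>i \<le> D\<close> the remaining index \<open>j - i\<close> exceeds
    \<open>n\<close>, hence is not exceptional for any generator.\<close>
  have "w \<otimes> x \<in> J (k + j + 1)" if j: "j \<ge> n + D + 1" and x: "x \<in> B j" for j x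
  proof -
    let ?K = "colon R (J (k + j + 1)) w"
    have "B j \<subseteq> ?K"
    proof (rule B_subset_by_split)
      show "ideal ?K R" by (rule colon_ideal[OF J_ideal w])
      show "j \<ge> 1" using j by simp
      fix i a b assume *: "1 \<le> i" "i \<le> D" "i \<le> j" "a \<in> B i" "b \<in> B (j - i)"
      have b: "b \<in> carrier R" using *(5) B_carrier by blast
      \<comment> \<open>For fixed \<open>b\<close> the condition is linear in \<open>a\<close>, so
        it suffices to check it on the generators \<open>F i\<close>.\<close>
      let ?K' = "colon R (J (k + j + 1)) (w \<otimes> b)"
      have "Idl (F i) \<subseteq> ?K'"
      proof (rule genideal_minimal)
        show "ideal ?K' R" using w b by (intro colon_ideal[OF J_ideal]) simp
        show "F i \<subseteq> ?K'"
        proof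
          fix f assume f: "f \<in> F i"
          then have fc: "f \<in> carrier R" using F(2) B_carrier by blast
          have "j - i \<notin> bad i f" using n[of i f "j - i"] f * j by auto
          then have "(f \<otimes> w) \<otimes> b \<in> J (k + i + (j - i) + 1)" using *(5) by (auto simp: bad_def)
          then show "f \<in> ?K'" using fc w b *(3) by (simp add: colon_def m_assoc)
        qed
      qed
      then have "a \<in> ?K'" using *(4) F(3) by blast
      then have "a \<in> carrier R" "a \<otimes> (w \<otimes> b) \<in> J (k + j + 1)" by (simp_all add: colon_def)
      moreover from this have "a \<otimes> (w \<otimes> b) = (a \<otimes> b) \<otimes> w" using w b by (simp add: m_ac)
      ultimately show "a \<otimes> b \<in> ?K" using b by (simp add: colon_def)
    qed
    then have "x \<in> ?K" using x by blast
    then show ?thesis using w m_comm[of w x] by (simp add: colon_def)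
  qed
  then have "j \<le> n + D" if "x \<in> B j" "w \<otimes> x \<notin> J (k + j + 1)" for j x
    using that not_less_eq_eq[of j "n + D"] by auto
  then have "{j. \<exists>x\<in>B j. w \<otimes> x \<notin> J (k + j + 1)} \<subseteq> {..n + D}" by blast
  then have "finite {j. \<exists>x\<in>B j. w \<otimes> x \<notin> J (k + j + 1)}" by (rule finite_subset) simp
  then show False using fert by (simp add: fertile_def)
qed

lemma fertile_not_mem:
  assumes "fertile w k"
  shows "w \<notin> J (k + 1)"
proof
  assume w: "w \<in> J (k + 1)"
  have "w \<otimes> x \<in> J (k + j + 1)" if "x \<in> B j" for x j
    using J_mult[OF w, of x j] that by (simp add: B_def ac_simps)
  then show False using assms by (auto simp: fertile_def)
qed

text \<open>Dependent choice: starting from \<open>\<one>\<close> at level 0,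
  \<open>fertile_step\<close> extends the pair of product and level forever, and
  \<open>fertile_not_mem\<close> gives the non-membership.\<close>

lemma degree_zero_chain:
  assumes u: "u \<in> J m" "u \<in> A 0" "u \<noteq> \<zero>" "m \<ge> 1"
  shows "\<exists>w \<kappa>. (\<forall>n. w n \<in> A 0) \<and> (\<forall>n. w n \<notin> J (\<kappa> n + 1)) \<and>
    (\<forall>n. \<exists>i y. 1 \<le> i \<and> i \<le> D \<and> \<kappa> (Suc n) = \<kappa> n + i \<and> y \<in> J i \<and> w (Suc n) = y \<otimes> w n)"
proof -
  define good where "good p \<longleftrightarrow> fst p \<in> A 0 \<and> fertile (fst p) (snd p)" for p :: "'a \<times> nat"
  define next_of where "next_of p q \<longleftrightarrow> (\<exists>i y. 1 \<le> i \<and> i \<le> D \<and> snd q = snd p + i \<and> y \<in> J i \<and> fst q = y \<otimes> fst p)"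
    for p q :: "'a \<times> nat"
  have "\<exists>s. \<forall>n. good (s n) \<and> next_of (s n) (s (Suc n))"
  proof (rule dependent_nat_choice)
    show "\<exists>p. good p"
      using fertile_one[OF u] one_homogeneous by (intro exI[of _ "(\<one>, 0)"]) (simp add: good_def)
    fix p and n :: nat assume p: "good p"
    then have p0: "fst p \<in> A 0" by (simp add: good_def)
    obtain i y where y: "1 \<le> i" "i \<le> D" "y \<in> B i" "fertile (y \<otimes> fst p) (snd p + i)"
      using p fertile_step[OF A_carrier[OF p0], of "snd p"] unfolding good_def by blast
    have "y \<otimes> fst p \<in> A 0" using A_mult[of y 0 "fst p" 0] y(3) p0 by (simp add: B_def)
    then show "\<exists>q. good q \<and> next_of p q"
      using y by (intro exI[of _ "(y \<otimes> fst p, snd p + i)"]) (auto simp: good_def next_of_def B_def)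
  qed
  then obtain s where s: "\<And>n. good (s n)" "\<And>n. next_of (s n) (s (Suc n))" by blast
  show ?thesis
  proof (intro exI[of _ "\<lambda>n. fst (s n)"] exI[of _ "\<lambda>n. snd (s n)"] conjI allI)
    show "fst (s n) \<in> A 0" "fst (s n) \<notin> J (snd (s n) + 1)" for n
      using s(1)[of n] fertile_not_mem by (auto simp: good_def)
    show "\<exists>i y. 1 \<le> i \<and> i \<le> D \<and> snd (s (Suc n)) = snd (s n) + i \<and> y \<in> J i \<and> fst (s (Suc n)) = y \<otimes> fst (s n)" for n
      using s(2)[of n] by (simp add: next_of_def)
  qed
qed

text \<open>The limit will be \<open>a / m\<close>; both sequences stay within a bounded distance of
  the line of that slope, apart from the lower bound for the v-number, which comes from
  \<open>ideg_le_v_number\<close>.\<close>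

lemma asymptotic_bounds:
  obtains m a C N where "m \<ge> 1" "\<forall>k. a * k \<le> m * ideg k" "\<forall>k. m * ideg k \<le> a * k + a * m"
    "\<forall>k\<ge>N. m * vnum k \<le> a * k + m * C"
proof -
  obtain m where m: "1 \<le> m" "m \<le> D" "\<forall>i. 1 \<le> i \<longrightarrow> i \<le> D \<longrightarrow> ideg m * i \<le> m * ideg i"
    using slope_minimum .
  define a where "a = ideg m"
  obtain u where u: "u \<in> J m" "u \<in> A a" "u \<noteq> \<zero>" unfolding a_def using ideg_attained .
  have uc: "u \<in> carrier R" using J_carrier u(1) .
  have deg: "a * k \<le> m * d" if "x \<in> J k" "x \<in> A d" "x \<noteq> \<zero>" for x k d
  proof (rule ccontr)
    assume "\<not> a * k \<le> m * d"
    then have "hcomp d x = \<zero>" using J_subset_high[of a m k] m(3) that(1) by (auto simp: high_def a_def)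
    then show False using hcomp_self[OF that(2)] that(3) by simp
  qed
  have lower: "a * k \<le> m * ideg k" for k
    using ideg_attained[of k] deg by metis
  have upper: "m * ideg k \<le> a * k + a * m" for k
  proof -
    \<comment> \<open>\<open>q * m\<close> exceeds \<open>k\<close> by at most \<open>m\<close>, so
      \<open>u [^] q\<close> lies in \<open>J k\<close> at the cost of at most one extra
      \<open>a\<close> in degree.\<close>
    define q where "q = k div m + 1"
    have "k mod m < m" using m(1) by simp
    then have "k \<le> q * m"
      using div_mult_mod_eq[of k m] unfolding q_def add_mult_distrib by linarith
    then have "u [^] q \<in> J k" using J_pow[OF u(1), of q] J_antimono by blast
    then have "ideg k \<le> q * a" using A_pow[OF u(2)] nat_pow_nonzero[OF uc u(3)] by (rule ideg_le)
    then have "m * ideg k \<le> m * (q * a)" by simp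
    also have "\<dots> = a * (m * (k div m)) + a * m" by (simp add: q_def algebra_simps)
    also have "\<dots> \<le> a * k + a * m" by simp
    finally show ?thesis .
  qed
  have "\<exists>C N. \<forall>k\<ge>N. m * vnum k \<le> a * k + m * C"
  proof -
    \<comment> \<open>The end shared by both cases: any chain whose degrees
      \<open>\<epsilon> n\<close> stay on or below the line of slope \<open>a / m\<close>.\<close>
    have conclude: ?thesis
      if w: "\<And>n. w n \<in> A (\<epsilon> n)" "\<And>n. w n \<notin> J (\<kappa> n + 1)"
        and step: "\<And>n. \<exists>i y. 1 \<le> i \<and> i \<le> D \<and> \<kappa> (Suc n) = \<kappa> n + i \<and> y \<in> J i \<and> w (Suc n) = y \<otimes> w n"
        and \<epsilon>: "\<And>n. m * \<epsilon> n \<le> a * \<kappa> n"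
      for w \<epsilon> \<kappa>
    proof -
      have "\<exists>C N. \<forall>k\<ge>N. \<exists>n. \<kappa> n \<le> k \<and> vnum k \<le> \<epsilon> n + C"
        using w step by (rule v_number_eventually_le_chain)
      then obtain C N where CN: "\<forall>k\<ge>N. \<exists>n. \<kappa> n \<le> k \<and> vnum k \<le> \<epsilon> n + C" by (elim exE)
      have "m * vnum k \<le> a * k + m * C" if k: "k \<ge> N" for k
      proof -
        obtain n where n: "\<kappa> n \<le> k" "vnum k \<le> \<epsilon> n + C" using CN k by blast
        have "m * vnum k \<le> m * \<epsilon> n + m * C" using n(2) by (metis add_mult_distrib2 mult_le_mono2)
        also have "\<dots> \<le> a * \<kappa> n + m * C" using \<epsilon> by simp
        also have "\<dots> \<le> a * k + m * C" using n(1) by simp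
        finally show ?thesis .
      qed
      then show ?thesis by (intro exI allI impI)
    qed
    show ?thesis
    proof (cases "a = 0")
      case True
      \<comment> \<open>Zero slope: degree arguments are void, so the chain is built from fertile
        elements.\<close>
      have "u \<in> A 0" using u(2) True by simp
      from degree_zero_chain[OF u(1) this u(3) m(1)] obtain w \<kappa>
        where "\<forall>n. w n \<in> A 0" "\<forall>n. w n \<notin> J (\<kappa> n + 1)"
          "\<forall>n. \<exists>i y. 1 \<le> i \<and> i \<le> D \<and> \<kappa> (Suc n) = \<kappa> n + i \<and> y \<in> J i \<and> w (Suc n) = y \<otimes> w n"
        by (elim exE conjE)
      then show ?thesis by (intro conclude[of w "\<lambda>_. 0" \<kappa>]) simp_all
    next
      case False
      \<comment> \<open>Positive slope: membership of \<open>u [^] n\<close> in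
        \<open>J (n * m + 1)\<close> would violate the slope bound by \<open>a\<close>, so the
        powers of \<open>u\<close> form the chain.\<close>
      show ?thesis
      proof (rule conclude[of "\<lambda>n. u [^] n" "\<lambda>n. n * a" "\<lambda>n. n * m"])
        show "u [^] n \<in> A (n * a)" for n by (rule A_pow[OF u(2)])
        show "u [^] n \<notin> J (n * m + 1)" for n
        proof
          assume "u [^] n \<in> J (n * m + 1)"
          from deg[OF this A_pow[OF u(2)] nat_pow_nonzero[OF uc u(3)]]
          have "a * (n * m) + a \<le> a * (n * m)" by (simp add: algebra_simps)
          then show False using False by simp
        qed
        show "\<exists>i y. 1 \<le> i \<and> i \<le> D \<and> Suc n * m = n * m + i \<and> y \<in> J i \<and> u [^] Suc n = y \<otimes> u [^] n" for n
          using m u(1) uc by (intro exI[of _ m] exI[of _ u]) (simp add: m_comm)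
      qed simp
    qed
  qed
  then obtain C N where "\<forall>k\<ge>N. m * vnum k \<le> a * k + m * C" by blast
  then show ?thesis using that[of m a N C] m(1) lower upper by blast
qed

lemma v_number_asymptotics:
  "(\<lambda>k. real (vnum k) / real k) \<longlonglongrightarrow> lim (\<lambda>k. real (ideg k) / real k)"
proof -
  obtain m a C N where m: "m \<ge> 1" and low: "\<forall>k. a * k \<le> m * ideg k"
    and up: "\<forall>k. m * ideg k \<le> a * k + a * m" and v: "\<forall>k\<ge>N. m * vnum k \<le> a * k + m * C"
    using asymptotic_bounds .
  obtain e where e: "\<forall>k\<ge>1. ideg k \<le> vnum k + e"
    using ideg_le_v_number by (elim exE)
  \<comment> \<open>An error bounded by \<open>b\<close> after multiplying by \<open>m\<close>
    becomes at most \<open>b / (m * k)\<close> in the quotient.\<close>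
  have squeeze: "(\<lambda>k. real (f k) / real k) \<longlonglongrightarrow> real a / real m"
    if f: "\<And>k. k \<ge> M \<Longrightarrow> a * k \<le> m * f k + b" "\<And>k. k \<ge> M \<Longrightarrow> m * f k \<le> a * k + b"
    for f :: "nat \<Rightarrow> nat" and b M
  proof (rule LIM_zero_cancel, rule tendsto_0_le[OF lim_inverse_n])
    have "norm (real (f k) / real k - real a / real m) \<le> norm (inverse (real k)) * (real b / real m)"
      if k: "k \<ge> max M 1" for k
    proof -
      have "real (a * k) \<le> real (m * f k + b)" "real (m * f k) \<le> real (a * k + b)"
        using f[of k] k by (simp_all only: of_nat_le_iff)
      then have "\<bar>real m * real (f k) - real a * real k\<bar> \<le> real b" by simp
      moreover have "real (f k) / real k - real a / real m =
          (real m * real (f k) - real a * real k) / (real m * real k)"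
        using k m by (simp add: field_simps)
      ultimately show ?thesis using k m by (simp add: abs_divide abs_mult divide_simps mult.commute)
    qed
    then show "\<forall>\<^sub>F k in sequentially.
        norm (real (f k) / real k - real a / real m) \<le> norm (inverse (real k)) * (real b / real m)"
      by (rule eventually_sequentiallyI)
  qed
  \<comment> \<open>\<open>lim\<close> denotes the limit only once convergence is known, so the
    initial degrees are shown to converge before the Waldschmidt constant is evaluated.\<close>
  have "(\<lambda>k. real (ideg k) / real k) \<longlonglongrightarrow> real a / real m"
    using low up by (intro squeeze[of 0 _ "a * m"]) (auto intro: trans_le_add1)
  then have "lim (\<lambda>k. real (ideg k) / real k) = real a / real m" by (rule limI)
  moreover have "(\<lambda>k. real (vnum k) / real k) \<longlonglongrightarrow> real a / real m"
  \<comment> \<open>The constant absorbs the loss \<open>m * e\<close> of the lower bound and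
    \<open>m * C\<close> of the upper one; the lower bound requires
    \<open>k \<ge> 1\<close>.\<close>
  proof (rule squeeze[of "max 1 N" _ "m * e + m * C"])
    fix k assume k: "k \<ge> max 1 N"
    have "a * k \<le> m * ideg k" using low by blast
    also have "\<dots> \<le> m * (vnum k + e)" using e k by simp
    finally show "a * k \<le> m * vnum k + (m * e + m * C)" by (simp add: add_mult_distrib2)
    show "m * vnum k \<le> a * k + (m * e + m * C)" using v[rule_format, of k] k by simp
  qed
  ultimately show ?thesis by simp
qed

end

theorem corollary3p6:
  fixes R :: "('a, 'b) ring_scheme"
    and A :: "nat \<Rightarrow> 'a set"
    and I :: "'a set"
    and c :: symbolic_convention
  assumes "noetherian_domain R"
    and "nat_graded R A"
    and "graded_ideal R A I"
    and "I \<noteq> {\<zero>\<^bsub>R\<^esub>}"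
    and "I \<noteq> carrier R"
    and "noetherian_ring (symbolic_Rees_algebra R c I)"
  shows "(\<lambda>k. real (v_number R A (symbolic_power R c I k)) / real k)
           \<longlonglongrightarrow> Waldschmidt_constant R A c I"
proof -
  interpret R: noetherian_domain R by fact
  interpret graded_noetherian_domain R A using assms(2) by unfold_locales
  interpret graded_filtration R A "symbolic_power R c I"
    using symbolic_power_filtration assms(3-5) by blast
  \<comment> \<open>Noetherianity of the symbolic Rees algebra enters here, as a bound
    \<open>D\<close> on the degrees of its generators.\<close>
  obtain D where "\<And>k. k \<ge> 1 \<Longrightarrow> symbolic_power R c I k \<subseteq> split D k"
    using Rees_noetherian_split assms(6) unfolding symbolic_Rees_algebra_def by blast
  then interpret noetherian_filtration R A "symbolic_power R c I" D by unfold_locales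
  show ?thesis using v_number_asymptotics by (simp add: Waldschmidt_constant_def)
qed

end
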